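(* Let $E\subseteq\Gamma$ be a set of multiplicity. Then there exists a nonzero distribution $\mu$ on $\Gamma$ whose support is a Kronecker set contained in $E$ and such that $\hat\mu(n)\to0$ as $n\to-\infty$.
   Context: $\Gamma$ is the unit circle; distributions on $\Gamma$ have Fourier coefficients $\hat\mu(n)=\langle\mu, e^{-int}\rangle$, $n\in\mathbb Z$. A closed set $E\subseteq\Gamma$ is a set of multiplicity if there is a nonzero distribution $S$ supported by $E$ with $\hat S(n)\to0$ as $|n|\to\infty$. A Kronecker set is a closed $K\subseteq\Gamma$ such that every continuous $u:K\to\Gamma$ is a uniform limit on $K$ of functions $z\mapsto z^n$, $n\in\mathbb Z$. *)

theory Defs
  imports "HOL-Analysis.Analysis"
begin

text \<open>The circle is parametrised by t \<mapsto> cis t; functions on the circle are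
  2pi-periodic functions real \<Rightarrow> complex.\<close>

definition circ :: "complex set" where
  "circ = sphere 0 1"

definition dn :: "nat \<Rightarrow> (real \<Rightarrow> complex) \<Rightarrow> real \<Rightarrow> complex" where
  "dn j = ((\<lambda>f x. vector_derivative f (at x)) ^^ j)"

definition test_fun :: "(real \<Rightarrow> complex) \<Rightarrow> bool" where
  "test_fun \<phi> \<longleftrightarrow> (\<forall>t. \<phi> (t + 2 * pi) = \<phi> t) \<and>
     (\<forall>j x. dn j \<phi> differentiable (at x))"

text \<open>Distributions: continuous linear functionals on the test functions
  (continuity in the C-infinity topology, i.e. bounded by finitely many seminorms).\<close>
definition distribution :: "((real \<Rightarrow> complex) \<Rightarrow> complex) \<Rightarrow> bool" where
  "distribution T \<longleftrightarrow>
     (\<forall>\<phi> \<psi>. test_fun \<phi> \<longrightarrow> test_fun \<psi> \<longrightarrow> T (\<lambda>t. \<phi> t + \<psi> t) = T \<phi> + T \<psi>) \<and>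
     (\<forall>\<phi> c. test_fun \<phi> \<longrightarrow> T (\<lambda>t. c * \<phi> t) = c * T \<phi>) \<and>
     (\<exists>C k. \<forall>\<phi>. test_fun \<phi> \<longrightarrow>
        norm (T \<phi>) \<le> C * (\<Sum>j\<le>k. (SUP x. norm (dn j \<phi> x))))"

definition nonzero_distr :: "((real \<Rightarrow> complex) \<Rightarrow> complex) \<Rightarrow> bool" where
  "nonzero_distr T \<longleftrightarrow> (\<exists>\<phi>. test_fun \<phi> \<and> T \<phi> \<noteq> 0)"

definition fourier_coeff :: "((real \<Rightarrow> complex) \<Rightarrow> complex) \<Rightarrow> int \<Rightarrow> complex" where
  "fourier_coeff T n = T (\<lambda>t. exp (- \<i> * of_int n * of_real t))"

definition distr_support :: "((real \<Rightarrow> complex) \<Rightarrow> complex) \<Rightarrow> complex set" where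
  "distr_support T = {z \<in> circ. \<forall>U. open U \<and> z \<in> U \<longrightarrow>
      (\<exists>\<phi>. test_fun \<phi> \<and> cis ` closure {t. \<phi> t \<noteq> 0} \<subseteq> U \<and> T \<phi> \<noteq> 0)}"

definition multiplicity_set :: "complex set \<Rightarrow> bool" where
  "multiplicity_set E \<longleftrightarrow> closed E \<and> E \<subseteq> circ \<and>
     (\<exists>S. distribution S \<and> nonzero_distr S \<and> distr_support S \<subseteq> E \<and>
          (fourier_coeff S \<longlongrightarrow> 0) at_top \<and> (fourier_coeff S \<longlongrightarrow> 0) at_bot)"

definition kronecker_set :: "complex set \<Rightarrow> bool" where
  "kronecker_set K \<longleftrightarrow> closed K \<and> K \<subseteq> circ \<and>
     (\<forall>u. continuous_on K u \<and> u ` K \<subseteq> circ \<longrightarrow>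
        (\<forall>e>0. \<exists>n::int. \<forall>z\<in>K. norm (u z - z powi n) < e))"

end

theory Submission
  imports Defs
begin

text \<open>
  Multiply a pseudofunction \<open>S\<close> supported by \<open>E\<close> successively by functions
  \<open>f t = g (n t - \<phi> t)\<close>, where \<open>g\<close> is smooth, supported near \<open>0\<close> modulo \<open>2 \<pi>\<close>, and \<open>g - 1\<close> has
  very small Fourier coefficients of nonpositive index. Such \<open>g\<close> exist because an analytic function
  on the disc can take the value \<open>1\<close> at \<open>0\<close> and be tiny on the complement of a short arc. On the support
  of \<open>f\<close> the function \<open>z ^ n\<close> is close to \<open>exp (\<i> \<phi>)\<close>, and for large \<open>n\<close> the product changes the
  negatively indexed coefficients uniformly little and the positively indexed ones little relative
  to linear growth. Hence the products converge to a distribution whose coefficients tend to \<open>0\<close>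
  at \<open>-\<infinity>\<close>. Letting \<open>\<phi>\<close> run through multiples of trigonometric monomials makes the support \<open>K\<close> a
  Kronecker set: the uniform limits on \<open>K\<close> of powers of \<open>z\<close> form a closed group, and every unimodular
  function on the proper closed subset \<open>K\<close> of the circle has a continuous logarithm.
\<close>

subsection \<open>Smooth functions\<close>

text \<open>The result is one-sided because the multiplier is. Off a short arc \<open>g - 1\<close>
  equals -1, so the absolute sum of its coefficients is at least 1 and cannot be made small.
  Analyticity serves to push this unavoidable mass onto positive indices: all powers of a polynomial
  with value 1 at 0 have mean 1 and no negative frequencies. The factor \<open>n\<close> then moves
  that mass far out. Starting from a frequency m above -n/2, a shift by k n with k > 0 lands where a
  pseudofunction is already small. Starting lower it may land anywhere, but then |m| exceeds n/2 and
  a bounded error is affordable relative to |m|. Hence errors carry the weight 1 + |min 0 m|, which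
  rapidly decreasing coefficients of test functions absorb; this is why the limit is sought among
  distributions. The multipliers must be smooth because they act on a distribution, and the order of
  smoothness actually estimated is four: a quadratic weight in k, caused by the second-order bounds
  for exp (- \<i> k \<phi>), plus two orders for summability.\<close>

definition diff_times :: "nat \<Rightarrow> (real \<Rightarrow> complex) \<Rightarrow> bool" where
  "diff_times j f \<longleftrightarrow> (\<forall>i<j. \<forall>x. dn i f differentiable (at x))"

definition smooth_fun :: "(real \<Rightarrow> complex) \<Rightarrow> bool" where
  "smooth_fun f \<longleftrightarrow> (\<forall>j. diff_times j f)"

lemma dn_0 [simp]: "dn 0 f = f"
  by (simp add: dn_def)

lemma dn_Suc: "dn (Suc j) f = dn j (\<lambda>x. vector_derivative f (at x))"
  by (simp only: dn_def funpow_Suc_right o_apply)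

lemma dn_Suc': "dn (Suc j) f = (\<lambda>x. vector_derivative (dn j f) (at x))"
  by (simp add: dn_def)

lemma dn_Suc_eq:
  assumes "\<And>x. (f has_vector_derivative f' x) (at x)"
  shows "dn (Suc j) f = dn j f'"
  using vector_derivative_at[OF assms] by (simp add: dn_Suc)

lemma diff_times_0 [simp]: "diff_times 0 f"
  by (simp add: diff_times_def)

text \<open>With \<open>diff_times_SucE\<close> this moves between orders one at a time, which is
  the reason for the graded notion: closure under products, composition and inverses is proved by
  induction on the order, and \<open>smooth_fun\<close> by itself offers nothing to induct
  on.\<close>

lemma diff_times_SucI:
  assumes "\<And>x. (f has_vector_derivative f' x) (at x)" "diff_times j f'"
  shows "diff_times (Suc j) f"
  unfolding diff_times_def
proof (intro allI impI)
  fix i x assume "i < Suc j"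
  then show "dn i f differentiable (at x)"
    using assms dn_Suc_eq[OF assms(1)]
    by (cases i) (auto simp: diff_times_def intro: differentiableI_vector)
qed

lemma diff_times_SucE:
  assumes "diff_times (Suc j) f"
  obtains f' where "\<And>x. (f has_vector_derivative f' x) (at x)" "diff_times j f'"
proof
  have d: "f differentiable (at x)" for x
    using assms by (auto simp: diff_times_def dest: spec[of _ 0])
  show "(f has_vector_derivative vector_derivative f (at x)) (at x)" for x
    using d vector_derivative_works by blast
  show "diff_times j (\<lambda>x. vector_derivative f (at x))"
    using assms by (fastforce simp: diff_times_def dn_Suc)
qed

lemma diff_times_mono: "diff_times j f \<Longrightarrow> i \<le> j \<Longrightarrow> diff_times i f"
  by (auto simp: diff_times_def)

lemma smooth_fun_derivE:
  assumes "smooth_fun f"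
  obtains f' where "\<And>x. (f has_vector_derivative f' x) (at x)" "smooth_fun f'"
proof
  have d: "f differentiable (at x)" for x
    using assms by (auto simp: smooth_fun_def diff_times_def dest: spec[of _ 1] spec[of _ 0])
  show "(f has_vector_derivative vector_derivative f (at x)) (at x)" for x
    using d vector_derivative_works by blast
  show "smooth_fun (\<lambda>x. vector_derivative f (at x))"
    using assms unfolding smooth_fun_def diff_times_def
    by (metis Suc_mono dn_Suc)
qed

lemma smooth_funI:
  assumes "\<And>x. (f has_vector_derivative f' x) (at x)" "smooth_fun f'"
  shows "smooth_fun f"
  unfolding smooth_fun_def
proof
  fix j show "diff_times j f"
    using diff_times_SucI[OF assms(1)] assms(2) by (cases j) (auto simp: smooth_fun_def)
qed

lemma diff_times_add:
  "diff_times j f \<Longrightarrow> diff_times j g \<Longrightarrow> diff_times j (\<lambda>x. f x + g x)"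
proof (induction j arbitrary: f g)
  case (Suc j)
  obtain f' where f: "\<And>x. (f has_vector_derivative f' x) (at x)" "diff_times j f'"
    using diff_times_SucE[OF Suc.prems(1)] by blast
  obtain g' where g: "\<And>x. (g has_vector_derivative g' x) (at x)" "diff_times j g'"
    using diff_times_SucE[OF Suc.prems(2)] by blast
  show ?case
    using f g Suc.IH by (intro diff_times_SucI[where f' = "\<lambda>x. f' x + g' x"] has_vector_derivative_add) auto
qed simp

lemma diff_times_mult:
  "diff_times j f \<Longrightarrow> diff_times j g \<Longrightarrow> diff_times j (\<lambda>x. f x * g x)"
proof (induction j arbitrary: f g)
  case (Suc j)
  obtain f' where f: "\<And>x. (f has_vector_derivative f' x) (at x)" "diff_times j f'"
    using diff_times_SucE[OF Suc.prems(1)] by blast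
  obtain g' where g: "\<And>x. (g has_vector_derivative g' x) (at x)" "diff_times j g'"
    using diff_times_SucE[OF Suc.prems(2)] by blast
  have "diff_times j f" "diff_times j g"
    using Suc.prems diff_times_mono by (auto intro: le_SucI)
  then show ?case
    using f g Suc.IH
    by (intro diff_times_SucI[where f' = "\<lambda>x. f x * g' x + f' x * g x"] has_vector_derivative_mult
        diff_times_add) auto
qed simp

text \<open>Inner functions of compositions are real, but their smoothness is stated for the
  complexified function so that \<open>smooth_fun\<close> serves both roles. Real parts recover an
  ordinary real derivative for the chain rule, and uniqueness of derivatives shows that the complex
  one is real.\<close>

lemma of_real_has_vector_derivative:
  assumes "((\<lambda>x. complex_of_real (\<eta> x)) has_vector_derivative d) (at x)"
  shows "(\<eta> has_real_derivative Re d) (at x)" "d = of_real (Re d)"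
proof -
  show d: "(\<eta> has_real_derivative Re d) (at x)"
    using has_derivative_Re[OF assms[unfolded has_vector_derivative_def]]
    by (simp add: has_field_derivative_def mult_commute_abs)
  then have "((\<lambda>x. complex_of_real (\<eta> x)) has_vector_derivative of_real (Re d)) (at x)"
    by (intro has_vector_derivative_of_real) (simp add: has_real_derivative_iff_has_vector_derivative)
  with assms show "d = of_real (Re d)"
    by (metis vector_derivative_at)
qed

lemma has_vector_derivative_compose_real:
  assumes "((\<lambda>x. complex_of_real (\<eta> x)) has_vector_derivative d) (at x)"
    and "(g has_vector_derivative g') (at (\<eta> x))"
  shows "((\<lambda>x. g (\<eta> x)) has_vector_derivative d * g') (at x)"
proof -
  have "((g \<circ> \<eta>) has_vector_derivative Re d *\<^sub>R g') (at x)"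
    using of_real_has_vector_derivative(1)[OF assms(1)] assms(2)
    by (intro vector_diff_chain_at) (auto simp: has_real_derivative_iff_has_vector_derivative)
  then show ?thesis
    using of_real_has_vector_derivative(2)[OF assms(1)] by (simp add: o_def scaleR_conv_of_real)
qed

lemma diff_times_compose:
  "diff_times j g \<Longrightarrow> diff_times j (\<lambda>x. complex_of_real (\<eta> x)) \<Longrightarrow> diff_times j (\<lambda>x. g (\<eta> x))"
proof (induction j arbitrary: g)
  case (Suc j)
  obtain g' where g: "\<And>x. (g has_vector_derivative g' x) (at x)" "diff_times j g'"
    using diff_times_SucE[OF Suc.prems(1)] by blast
  obtain d where d: "\<And>x. ((\<lambda>x. complex_of_real (\<eta> x)) has_vector_derivative d x) (at x)" "diff_times j d"
    using diff_times_SucE[OF Suc.prems(2)] by blast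
  have "diff_times j (\<lambda>x. complex_of_real (\<eta> x))"
    using Suc.prems diff_times_mono by (auto intro: le_SucI)
  then show ?case
    using g d Suc.IH
    by (intro diff_times_SucI[where f' = "\<lambda>x. d x * g' (\<eta> x)"] diff_times_mult
        has_vector_derivative_compose_real) auto
qed simp

lemma diff_times_const: "diff_times j (\<lambda>x. c)"
proof (induction j arbitrary: c)
  case (Suc j)
  show ?case by (rule diff_times_SucI[where f' = "\<lambda>x. 0"]) (auto simp: Suc)
qed simp

text \<open>The derivative of 1/f is -f' (1/f)^2, which contains 1/f again, but only one order less
  of it is needed, and induction supplies that.\<close>

lemma diff_times_inverse:
  "diff_times j f \<Longrightarrow> (\<And>x. f x \<noteq> 0) \<Longrightarrow> diff_times j (\<lambda>x. inverse (f x))"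
proof (induction j arbitrary: f)
  case (Suc j)
  obtain f' where f: "\<And>x. (f has_vector_derivative f' x) (at x)" "diff_times j f'"
    using diff_times_SucE[OF Suc.prems(1)] by blast
  have "((\<lambda>x. inverse (f x)) has_vector_derivative (((-1) * f' x) * (inverse (f x) * inverse (f x)))) (at x)" for x
  proof -
    have "((inverse \<circ> f) has_vector_derivative (f' x * - (inverse (f x) ^ 2))) (at x)"
      using Suc.prems(2) f(1) by (intro field_vector_diff_chain_at) (auto intro!: derivative_eq_intros simp: power2_eq_square)
    then show ?thesis
      by (simp add: o_def power2_eq_square)
  qed
  moreover have "diff_times j (\<lambda>x. inverse (f x))"
    using Suc diff_times_mono by (auto intro: le_SucI)
  ultimately show ?case
    using f by (intro diff_times_SucI[where f' = "\<lambda>x. ((-1) * f' x) * (inverse (f x) * inverse (f x))"]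
        diff_times_mult diff_times_const) auto
qed simp

lemma smooth_fun_const [simp, intro]: "smooth_fun (\<lambda>x. c)"
  by (simp add: smooth_fun_def diff_times_const)

lemma smooth_fun_add [intro]: "smooth_fun f \<Longrightarrow> smooth_fun g \<Longrightarrow> smooth_fun (\<lambda>x. f x + g x)"
  by (simp add: smooth_fun_def diff_times_add)

lemma smooth_fun_mult [intro]: "smooth_fun f \<Longrightarrow> smooth_fun g \<Longrightarrow> smooth_fun (\<lambda>x. f x * g x)"
  by (simp add: smooth_fun_def diff_times_mult)

lemma smooth_fun_inverse: "smooth_fun f \<Longrightarrow> (\<And>x. f x \<noteq> 0) \<Longrightarrow> smooth_fun (\<lambda>x. inverse (f x))"
  by (simp add: smooth_fun_def diff_times_inverse)

lemma smooth_fun_compose: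
  "smooth_fun g \<Longrightarrow> smooth_fun (\<lambda>x. complex_of_real (\<eta> x)) \<Longrightarrow> smooth_fun (\<lambda>x. g (\<eta> x))"
  by (simp add: smooth_fun_def diff_times_compose)

lemma smooth_fun_diff: "smooth_fun f \<Longrightarrow> smooth_fun g \<Longrightarrow> smooth_fun (\<lambda>x. f x - g x)"
  using smooth_fun_add[of f "\<lambda>x. (-1) * g x"] smooth_fun_mult[of "\<lambda>_. -1" g] by simp

lemma smooth_fun_of_real: "smooth_fun complex_of_real"
  by (rule smooth_funI[where f' = "\<lambda>_. 1"]) (auto intro!: derivative_eq_intros)

lemma smooth_fun_continuous: "smooth_fun f \<Longrightarrow> continuous_on A f"
  by (metis smooth_fun_derivE continuous_at_imp_continuous_on has_vector_derivative_continuous)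

lemma smooth_fun_dn: "smooth_fun f \<Longrightarrow> smooth_fun (dn j f)"
proof (induction j arbitrary: f)
  case (Suc j)
  then show ?case by (metis dn_Suc_eq smooth_fun_derivE)
qed simp

lemma dn_has_vector_derivative:
  assumes "smooth_fun f"
  shows "(dn j f has_vector_derivative dn (Suc j) f x) (at x)"
  unfolding dn_Suc'
  by (metis smooth_fun_dn[OF assms] smooth_fun_derivE vector_derivative_at)

lemma dn_add:
  "smooth_fun f \<Longrightarrow> smooth_fun g \<Longrightarrow> dn j (\<lambda>x. f x + g x) = (\<lambda>x. dn j f x + dn j g x)"
proof (induction j)
  case (Suc j)
  have "((\<lambda>x. dn j f x + dn j g x) has_vector_derivative dn (Suc j) f x + dn (Suc j) g x) (at x)" for x
    using Suc.prems by (intro has_vector_derivative_add dn_has_vector_derivative)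
  from vector_derivative_at[OF this] show ?case
    by (simp add: dn_Suc'[of j "\<lambda>x. f x + g x"] Suc.IH[OF Suc.prems])
qed simp

lemma dn_cmult: "smooth_fun f \<Longrightarrow> dn j (\<lambda>x. c * f x) = (\<lambda>x. c * dn j f x)"
proof (induction j)
  case (Suc j)
  have "((\<lambda>x. c * dn j f x) has_vector_derivative c * dn (Suc j) f x) (at x)" for x
    using has_vector_derivative_mult[OF has_vector_derivative_const[of c] dn_has_vector_derivative[OF Suc.prems]]
    by simp
  from vector_derivative_at[OF this] show ?case
    by (simp add: dn_Suc'[of j "\<lambda>x. c * f x"] Suc.IH[OF Suc.prems])
qed simp

lemma dn_diff:
  assumes "smooth_fun f" "smooth_fun g"
  shows "dn j (\<lambda>x. f x - g x) = (\<lambda>x. dn j f x - dn j g x)"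
  using dn_add[OF assms(1) smooth_fun_mult[OF smooth_fun_const[of "-1"] assms(2)], of j]
    dn_cmult[OF assms(2), of j "-1"] by simp

subsection \<open>Test functions\<close>

lemma test_fun_iff: "test_fun f \<longleftrightarrow> (\<forall>t. f (t + 2 * pi) = f t) \<and> smooth_fun f"
  by (auto simp: test_fun_def smooth_fun_def diff_times_def)

lemma test_fun_smooth: "test_fun f \<Longrightarrow> smooth_fun f"
  by (simp add: test_fun_iff)

lemma test_fun_const [simp, intro]: "test_fun (\<lambda>x. c)"
  by (simp add: test_fun_iff)

lemma test_fun_add [intro]: "test_fun f \<Longrightarrow> test_fun g \<Longrightarrow> test_fun (\<lambda>x. f x + g x)"
  by (simp add: test_fun_iff smooth_fun_add)

lemma test_fun_diff [intro]: "test_fun f \<Longrightarrow> test_fun g \<Longrightarrow> test_fun (\<lambda>x. f x - g x)"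
  by (simp add: test_fun_iff smooth_fun_diff)

lemma test_fun_mult [intro]: "test_fun f \<Longrightarrow> test_fun g \<Longrightarrow> test_fun (\<lambda>x. f x * g x)"
  by (simp add: test_fun_iff smooth_fun_mult)

lemma test_fun_power [intro]: "test_fun f \<Longrightarrow> test_fun (\<lambda>x. f x ^ n)"
  by (induction n) auto

lemma test_fun_sum [intro]: "(\<And>i. i \<in> I \<Longrightarrow> test_fun (f i)) \<Longrightarrow> test_fun (\<lambda>x. \<Sum>i\<in>I. f i x)"
  by (induction I rule: infinite_finite_induct) auto

lemma has_vector_derivative_shift:
  fixes f :: "real \<Rightarrow> complex"
  assumes "(f has_vector_derivative d) (at (t + a))"
  shows "((\<lambda>s. f (s + a)) has_vector_derivative d) (at t)"
proof -
  have "((\<lambda>s. s + a) has_vector_derivative 1) (at t)"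
    by (auto intro!: derivative_eq_intros simp: has_real_derivative_iff_has_vector_derivative[symmetric])
  from vector_diff_chain_at[OF this assms] show ?thesis
    by (simp add: o_def)
qed

lemma periodic_add_int:
  fixes f :: "real \<Rightarrow> 'a"
  assumes "\<And>t. f (t + 2 * pi) = f t"
  shows "f (t + 2 * pi * of_int n) = f t"
proof -
  have *: "f (t + 2 * pi * real n) = f t" for n t
  proof (induction n arbitrary: t)
    case (Suc n)
    have "t + 2 * pi * real (Suc n) = (t + 2 * pi * real n) + 2 * pi"
      by (simp add: algebra_simps)
    then show ?case using Suc assms by metis
  qed simp
  show ?thesis
  proof (cases "n \<ge> 0")
    case True then show ?thesis using *[of t "nat n"] by simp
  next
    case False
    then show ?thesis using *[of "t + 2 * pi * of_int n" "nat (-n)"] by simp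
  qed
qed

lemma test_fun_dn: "test_fun f \<Longrightarrow> test_fun (dn j f)"
proof (induction j)
  case (Suc j)
  have "dn (Suc j) f (t + 2 * pi) = dn (Suc j) f t" for t
  proof -
    have "(dn j f has_vector_derivative dn (Suc j) f (t + 2 * pi)) (at (t + 2 * pi))"
      by (rule dn_has_vector_derivative[OF test_fun_smooth[OF Suc.prems]])
    then have "((\<lambda>s. dn j f (s + 2 * pi)) has_vector_derivative dn (Suc j) f (t + 2 * pi)) (at t)"
      by (rule has_vector_derivative_shift)
    moreover have "(\<lambda>s. dn j f (s + 2 * pi)) = dn j f"
      using Suc by (simp add: test_fun_iff)
    ultimately show ?thesis
      using dn_has_vector_derivative[OF test_fun_smooth[OF Suc.prems]]
      by (metis vector_derivative_at)
  qed
  then show ?case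
    using Suc.prems smooth_fun_dn by (simp add: test_fun_iff)
qed simp

lemma reduce_mod_2pi:
  obtains s where "s \<in> {0..2*pi}" "\<And>f :: real \<Rightarrow> 'a. (\<And>t. f (t + 2 * pi) = f t) \<Longrightarrow> f t = f s"
proof
  define n where "n = \<lfloor>t / (2 * pi)\<rfloor>"
  have "of_int n \<le> t / (2 * pi)" "t / (2 * pi) \<le> of_int n + 1"
    by (auto simp: n_def)
  then show "t + 2 * pi * of_int (- n) \<in> {0..2*pi}"
    by (auto simp: field_simps)
  show "f t = f (t + 2 * pi * of_int (- n))" if "\<And>t. f (t + 2 * pi) = f t" for f :: "real \<Rightarrow> 'a"
    using periodic_add_int[of f t "- n", OF that] by simp
qed

lemma test_fun_bounded:
  assumes "test_fun f"
  shows "bdd_above (range (\<lambda>x. norm (f x)))"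
proof -
  have "compact (f ` {0..2*pi})"
    using assms test_fun_smooth smooth_fun_continuous by (intro compact_continuous_image) auto
  then obtain B where B: "\<And>x. x \<in> {0..2*pi} \<Longrightarrow> norm (f x) \<le> B"
    by (metis bounded_iff compact_imp_bounded imageI)
  have "norm (f t) \<le> B" for t
  proof -
    obtain s where "s \<in> {0..2*pi}" "f t = f s"
      using reduce_mod_2pi[of t] assms by (metis (no_types) test_fun_iff)
    then show ?thesis using B by simp
  qed
  then show ?thesis by (auto intro!: bdd_aboveI)
qed

section \<open>Supremum norms and the seminorms that bound distributions\<close>

definition supnorm :: "(real \<Rightarrow> complex) \<Rightarrow> real" where
  "supnorm f = (SUP x. norm (f x))"

definition seminorm :: "nat \<Rightarrow> (real \<Rightarrow> complex) \<Rightarrow> real" where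
  "seminorm k f = (\<Sum>j\<le>k. supnorm (dn j f))"

lemma norm_le_supnorm: "test_fun f \<Longrightarrow> norm (f x) \<le> supnorm f"
  unfolding supnorm_def by (rule cSUP_upper[OF _ test_fun_bounded]) auto

lemma supnorm_le: "(\<And>x. norm (f x) \<le> B) \<Longrightarrow> supnorm f \<le> B"
  unfolding supnorm_def by (rule cSUP_least) auto

lemma supnorm_nonneg: "test_fun f \<Longrightarrow> 0 \<le> supnorm f"
  by (rule order_trans[OF norm_ge_zero norm_le_supnorm])

lemma seminorm_nonneg: "test_fun f \<Longrightarrow> 0 \<le> seminorm k f"
  unfolding seminorm_def by (auto intro!: sum_nonneg supnorm_nonneg test_fun_dn)

lemma seminorm_mono: "test_fun f \<Longrightarrow> j \<le> k \<Longrightarrow> seminorm j f \<le> seminorm k f"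
  unfolding seminorm_def by (auto intro!: sum_mono2 supnorm_nonneg test_fun_dn)

lemma seminorm_le:
  assumes "\<And>j x. j \<le> k \<Longrightarrow> norm (dn j f x) \<le> B"
  shows "seminorm k f \<le> (k + 1) * B"
proof -
  have "seminorm k f \<le> (\<Sum>j\<le>k. B)"
    unfolding seminorm_def using assms by (intro sum_mono supnorm_le) auto
  then show ?thesis by (simp add: algebra_simps)
qed

lemma seminorm_deriv_le:
  assumes "test_fun g" "\<And>x. (g has_vector_derivative g' x) (at x)"
  shows "seminorm j g' \<le> seminorm (Suc j) g"
proof -
  have "seminorm j g' = (\<Sum>i\<le>j. supnorm (dn (Suc i) g))"
    unfolding seminorm_def using dn_Suc_eq[OF assms(2)] by simp
  also have "\<dots> \<le> seminorm (Suc j) g"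
    unfolding seminorm_def sum.atMost_Suc_shift using supnorm_nonneg[OF assms(1)] by simp
  finally show ?thesis .
qed

lemma test_fun_deriv:
  assumes "test_fun f" "\<And>x. (f has_vector_derivative f' x) (at x)"
  shows "test_fun f'"
  using test_fun_dn[OF assms(1), of 1] dn_Suc_eq[OF assms(2), of 0] by simp

lemma test_fun_derivE:
  assumes "test_fun f"
  obtains f' where "\<And>x. (f has_vector_derivative f' x) (at x)" "test_fun f'"
  by (metis assms smooth_fun_derivE test_fun_deriv test_fun_smooth)

lemma test_fun_compose:
  assumes "test_fun g" "smooth_fun (\<lambda>t. complex_of_real (\<eta> t))"
    and "\<And>t. \<eta> (t + 2 * pi) = \<eta> t + 2 * pi * of_int n"
  shows "test_fun (\<lambda>t. g (\<eta> t))"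
  using assms periodic_add_int[of g] by (simp add: test_fun_iff smooth_fun_compose)

text \<open>Differentiating \<open>h t * g (\<eta> t)\<close> gives two terms of the same shape,
  with factors \<open>h'\<close> and \<open>h\<close> times \<open>\<eta>'\<close>. So the induction
  runs over all \<open>h\<close> with \<open>\<eta>\<close> fixed, and the constant never sees
  \<open>g\<close>, as continuity in \<open>g\<close> requires.\<close>

lemma dn_mult_compose_bound:
  assumes \<eta>: "smooth_fun (\<lambda>t. complex_of_real (\<eta> t))"
    and per: "\<And>t. \<eta> (t + 2 * pi) = \<eta> t + 2 * pi * of_int n"
    and h: "test_fun h"
  shows "\<exists>C\<ge>0. \<forall>g. test_fun g \<longrightarrow> (\<forall>x. norm (dn j (\<lambda>t. h t * g (\<eta> t)) x) \<le> C * seminorm j g)"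
  using h
proof (induction j arbitrary: h)
  case 0
  have "norm (h x * g (\<eta> x)) \<le> supnorm h * seminorm 0 g" if "test_fun g" for g x
    unfolding norm_mult seminorm_def
    using that 0 by (auto intro!: mult_mono norm_le_supnorm supnorm_nonneg)
  then show ?case using supnorm_nonneg[OF 0] by auto
next
  case (Suc j)
  obtain h' where h': "\<And>x. (h has_vector_derivative h' x) (at x)" "test_fun h'"
    using test_fun_derivE[OF Suc.prems] by blast
  obtain d where d: "\<And>x. ((\<lambda>t. complex_of_real (\<eta> t)) has_vector_derivative d x) (at x)" "smooth_fun d"
    using smooth_fun_derivE[OF \<eta>] by blast
  \<comment> \<open>\<open>\<eta>\<close> is periodic only up to a multiple of 2 pi, but that
    constant disappears on differentiation, so the derivative is a test function and can be absorbed
    into \<open>h\<close>.\<close>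
  have "d (t + 2 * pi) = d t" for t
  proof -
    have "((\<lambda>s. complex_of_real (\<eta> (s + 2 * pi))) has_vector_derivative d (t + 2 * pi)) (at t)"
      using has_vector_derivative_shift[OF d(1)] .
    moreover have "((\<lambda>s. complex_of_real (\<eta> (s + 2 * pi))) has_vector_derivative d t) (at t)"
      using has_vector_derivative_add[OF d(1)[of t] has_vector_derivative_const[of "complex_of_real (2 * pi * of_int n)"]]
      by (simp add: per)
    ultimately show ?thesis by (metis vector_derivative_at)
  qed
  then have dt: "test_fun d" using d by (simp add: test_fun_iff)
  have hd: "test_fun (\<lambda>t. h t * d t)" using Suc.prems dt by auto
  obtain C1 where C1: "C1 \<ge> 0" "\<And>g x. test_fun g \<Longrightarrow> norm (dn j (\<lambda>t. h' t * g (\<eta> t)) x) \<le> C1 * seminorm j g"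
    using Suc.IH[OF h'(2)] by blast
  obtain C2 where C2: "C2 \<ge> 0" "\<And>g x. test_fun g \<Longrightarrow> norm (dn j (\<lambda>t. (h t * d t) * g (\<eta> t)) x) \<le> C2 * seminorm j g"
    using Suc.IH[OF hd] by blast
  have "norm (dn (Suc j) (\<lambda>t. h t * g (\<eta> t)) x) \<le> (C1 + C2) * seminorm (Suc j) g" if g: "test_fun g" for g x
  proof -
    obtain g' where g': "\<And>x. (g has_vector_derivative g' x) (at x)" "test_fun g'"
      using test_fun_derivE[OF g] by blast
    have "((\<lambda>t. h t * g (\<eta> t)) has_vector_derivative h' t * g (\<eta> t) + (h t * d t) * g' (\<eta> t)) (at t)" for t
      using has_vector_derivative_mult[OF h'(1) has_vector_derivative_compose_real[OF d(1) g'(1)]]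
      by (simp add: algebra_simps)
    then have "dn (Suc j) (\<lambda>t. h t * g (\<eta> t)) = dn j (\<lambda>t. h' t * g (\<eta> t) + (h t * d t) * g' (\<eta> t))"
      by (rule dn_Suc_eq)
    also have "\<dots> = (\<lambda>x. dn j (\<lambda>t. h' t * g (\<eta> t)) x + dn j (\<lambda>t. (h t * d t) * g' (\<eta> t)) x)"
      by (intro dn_add smooth_fun_mult[OF test_fun_smooth[OF h'(2)] smooth_fun_compose[OF test_fun_smooth[OF g] \<eta>]]
          smooth_fun_mult[OF test_fun_smooth[OF hd] smooth_fun_compose[OF test_fun_smooth[OF g'(2)] \<eta>]])
    finally have "norm (dn (Suc j) (\<lambda>t. h t * g (\<eta> t)) x) \<le> C1 * seminorm j g + C2 * seminorm j g'"
      using C1(2)[OF g, of x] C2(2)[OF g'(2), of x] by (simp add: norm_triangle_le)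
    also have "\<dots> \<le> C1 * seminorm (Suc j) g + C2 * seminorm (Suc j) g"
      using C1 C2 seminorm_mono[OF g, of j "Suc j"] seminorm_deriv_le[OF g g'(1), of j]
      by (intro add_mono mult_left_mono) auto
    finally show ?thesis by (simp add: algebra_simps)
  qed
  then show ?case using C1(1) C2(1) by (intro exI[of _ "C1 + C2"]) auto
qed

lemma seminorm_mult_compose:
  assumes \<eta>: "smooth_fun (\<lambda>t. complex_of_real (\<eta> t))"
    and per: "\<And>t. \<eta> (t + 2 * pi) = \<eta> t + 2 * pi * of_int n"
    and h: "test_fun h"
  shows "\<exists>C\<ge>0. \<forall>g. test_fun g \<longrightarrow> seminorm k (\<lambda>t. h t * g (\<eta> t)) \<le> C * seminorm k g"
proof -
  obtain C where C: "\<And>j. C j \<ge> 0"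
    "\<And>j g x. test_fun g \<Longrightarrow> norm (dn j (\<lambda>t. h t * g (\<eta> t)) x) \<le> C j * seminorm j g"
    using dn_mult_compose_bound[OF assms] by metis
  have "seminorm k (\<lambda>t. h t * g (\<eta> t)) \<le> sum C {..k} * seminorm k g" if "test_fun g" for g
    unfolding seminorm_def[of _ "\<lambda>t. h t * g (\<eta> t)"] sum_distrib_right
    using that C order_trans[OF C(2)[OF that] mult_left_mono[OF seminorm_mono[OF that] C(1)]]
    by (intro sum_mono supnorm_le) auto
  then show ?thesis using C(1) by (intro exI[of _ "sum C {..k}"]) (auto intro: sum_nonneg)
qed

subsection \<open>Fourier coefficients and inversion\<close>

definition expi :: "int \<Rightarrow> real \<Rightarrow> complex" where
  "expi m t = exp (\<i> * of_int m * of_real t)"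

definition fc :: "(real \<Rightarrow> complex) \<Rightarrow> int \<Rightarrow> complex" where
  "fc f m = integral {0..2*pi} (\<lambda>t. f t * expi (- m) t) / (2 * pi)"

lemma expi_cis: "expi m t = cis (of_int m * t)"
  by (simp add: expi_def cis_conv_exp mult.assoc)

lemma expi_0 [simp]: "expi 0 t = 1"
  by (simp add: expi_def)

lemma expi_add: "expi (m + n) t = expi m t * expi n t"
  by (simp add: expi_cis cis_mult ring_distribs)

lemma norm_expi [simp]: "norm (expi m t) = 1"
  by (simp add: expi_cis)

lemma cnj_expi: "cnj (expi m t) = expi (- m) t"
  by (simp add: expi_cis cis_cnj)

lemma expi_has_vector_derivative: "(expi m has_vector_derivative (\<i> * of_int m) * expi m t) (at t)"
proof -
  have "((\<lambda>z. exp (\<i> * of_int m * z)) has_field_derivative (\<i> * of_int m) * exp (\<i> * of_int m * of_real t)) (at (of_real t))"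
    by (auto intro!: derivative_eq_intros)
  then show ?thesis
    unfolding expi_def[abs_def] by (rule has_vector_derivative_real_field)
qed

lemma continuous_on_expi [continuous_intros]: "continuous_on A (expi m)"
  unfolding expi_def by (intro continuous_intros)

lemma expi_periodic: "expi m (t + 2 * pi) = expi m t"
proof -
  have "expi m (t + 2 * pi) = cis (of_int m * t) * cis (2 * pi * of_int m)"
    unfolding expi_cis cis_mult by (simp add: algebra_simps)
  then show ?thesis by (simp add: expi_cis)
qed

lemma diff_times_expi: "diff_times j (\<lambda>t. c * expi m t)"
proof (induction j arbitrary: c)
  case (Suc j)
  have "((\<lambda>t. c * expi m t) has_vector_derivative (c * (\<i> * of_int m)) * expi m t) (at t)" for t
    using has_vector_derivative_mult[OF has_vector_derivative_const expi_has_vector_derivative]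
    by (simp add: mult.assoc)
  then show ?case using Suc by (rule diff_times_SucI)
qed simp

lemma test_fun_expi [simp, intro]: "test_fun (expi m)"
  using diff_times_expi[of _ 1 m] by (simp add: test_fun_iff expi_periodic smooth_fun_def)

lemma dn_expi: "dn j (expi m) = (\<lambda>t. (\<i> * of_int m) ^ j * expi m t)"
proof (induction j)
  case (Suc j)
  have "dn (Suc j) (expi m) = dn j (\<lambda>t. (\<i> * of_int m) * expi m t)"
    by (rule dn_Suc_eq[OF expi_has_vector_derivative])
  also have "\<dots> = (\<lambda>t. (\<i> * of_int m) * ((\<i> * of_int m) ^ j * expi m t))"
    unfolding dn_cmult[OF test_fun_smooth[OF test_fun_expi]] Suc ..
  finally show ?case by (simp add: mult.assoc)
qed simp

lemma fc_integrable:
  "continuous_on UNIV f \<Longrightarrow> (\<lambda>t. f t * expi m t) integrable_on {0..2*pi}"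
  by (intro integrable_continuous_real continuous_intros) (auto intro: continuous_on_subset)

lemma fc_add:
  assumes "continuous_on UNIV f" "continuous_on UNIV g"
  shows "fc (\<lambda>t. f t + g t) m = fc f m + fc g m"
  unfolding fc_def by (simp add: ring_distribs integral_add fc_integrable assms add_divide_distrib)

lemma fc_cmult: "fc (\<lambda>t. c * f t) m = c * fc f m"
  unfolding fc_def by (simp add: mult.assoc)

lemma fc_diff:
  assumes "continuous_on UNIV f" "continuous_on UNIV g"
  shows "fc (\<lambda>t. f t - g t) m = fc f m - fc g m"
  using fc_add[OF assms(1) continuous_on_mult[OF continuous_on_const[of _ "-1"] assms(2)], of m]
    fc_cmult[of "-1" g m] by simp

lemma fc_0 [simp]: "fc (\<lambda>t. 0) m = 0"
  by (simp add: fc_def)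

lemma fc_sum:
  "finite I \<Longrightarrow> (\<And>i. i \<in> I \<Longrightarrow> continuous_on UNIV (f i)) \<Longrightarrow> fc (\<lambda>t. \<Sum>i\<in>I. f i t) m = (\<Sum>i\<in>I. fc (f i) m)"
  by (induction I rule: finite_induct) (auto simp: fc_add continuous_on_sum)

lemma norm_fc_le:
  assumes "continuous_on UNIV f" "\<And>t. norm (f t) \<le> B"
  shows "norm (fc f m) \<le> B"
proof -
  have "norm (integral {0..2*pi} (\<lambda>t. f t * expi (- m) t)) \<le> B * (2 * pi - 0)"
    using assms by (intro integral_bound continuous_intros) (auto simp: norm_mult intro: continuous_on_subset)
  then show ?thesis
    unfolding fc_def norm_divide by (simp add: field_simps)
qed

lemma integral_deriv_periodic:
  assumes "\<And>t. (F has_vector_derivative f t) (at t)" "F (2 * pi) = F 0"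
  shows "integral {0..2*pi} f = (0::complex)"
proof -
  have "(f has_integral (F (2 * pi) - F 0)) {0..2*pi}"
    using assms by (intro fundamental_theorem_of_calculus) (auto intro: has_vector_derivative_at_within)
  then show ?thesis using assms(2) by (simp add: integral_unique)
qed

lemma fc_deriv:
  assumes "test_fun f" "\<And>x. (f has_vector_derivative f' x) (at x)"
  shows "fc f' m = (\<i> * of_int m) * fc f m"
proof -
  have c: "continuous_on UNIV f" "continuous_on UNIV f'"
    using assms test_fun_deriv test_fun_smooth smooth_fun_continuous by blast+
  have "integral {0..2*pi} (\<lambda>t. f t * ((\<i> * of_int (- m)) * expi (- m) t) + f' t * expi (- m) t) = 0"
    by (rule integral_deriv_periodic[OF has_vector_derivative_mult[OF assms(2) expi_has_vector_derivative]])
       (use assms(1) expi_periodic[of "- m" 0] in \<open>auto simp: test_fun_iff dest: spec[of _ 0]\<close>)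
  also have "(\<lambda>t. f t * ((\<i> * of_int (- m)) * expi (- m) t) + f' t * expi (- m) t)
      = (\<lambda>t. f' t * expi (- m) t - (\<i> * of_int m) * (f t * expi (- m) t))"
    by (auto simp: algebra_simps)
  finally show ?thesis
    using c unfolding fc_def by (simp add: integral_diff fc_integrable integrable_on_mult_right)
qed

lemma fc_dn: "test_fun f \<Longrightarrow> fc (dn j f) m = (\<i> * of_int m) ^ j * fc f m"
proof (induction j)
  case (Suc j)
  show ?case
    using fc_deriv[OF test_fun_dn[OF Suc.prems] dn_has_vector_derivative[OF test_fun_smooth[OF Suc.prems]], of j m]
      Suc by (simp add: mult.assoc)
qed simp

lemma fc_expi: "fc (expi k) m = (if k = m then 1 else 0)"
proof (cases "k = m")
  case True
  have "expi k t * expi (- m) t = 1" for t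
    using expi_add[of k "- m" t] True by simp
  then show ?thesis using True by (simp add: fc_def scaleR_conv_of_real)
next
  case False
  have "(\<i> * of_int k) * fc (expi k) m = (\<i> * of_int m) * fc (expi k) m"
    using fc_deriv[OF test_fun_expi expi_has_vector_derivative] fc_cmult by metis
  then show ?thesis using False by simp
qed

text \<open>\<open>f\<close> itself controls small \<open>m\<close>, its derivative of order
  \<open>k + 2\<close> controls large \<open>m\<close>. Two orders more than the weight asks for
  leave a spare factor (1 + |m|)^2, at least 1 + m^2, hence a summable majorant.\<close>

lemma fc_decay:
  assumes "test_fun f"
  shows "norm (fc f m) * (1 + \<bar>of_int m\<bar>) ^ k \<le> 2 ^ (k + 2) * seminorm (k + 2) f * inverse (1 + (of_int m)\<^sup>2)"
proof -
  have c: "continuous_on UNIV (dn j f)" for j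
    using assms test_fun_dn test_fun_smooth smooth_fun_continuous by blast
  have 1: "norm (fc f m) \<le> supnorm (dn 0 f)"
    using c[of 0] norm_le_supnorm[OF assms] by (intro norm_fc_le) auto
  have "norm (fc (dn (k + 2) f) m) \<le> supnorm (dn (k + 2) f)"
    using c norm_le_supnorm[OF test_fun_dn[OF assms]] by (intro norm_fc_le) auto
  then have 2: "\<bar>of_int m\<bar> ^ (k + 2) * norm (fc f m) \<le> supnorm (dn (k + 2) f)"
    using fc_dn[OF assms, of "k + 2" m] by (simp add: norm_mult norm_power)
  have "supnorm (dn 0 f) + supnorm (dn (k + 2) f) = (\<Sum>j\<in>{0, k + 2}. supnorm (dn j f))"
    by simp
  also have "\<dots> \<le> seminorm (k + 2) f"
    unfolding seminorm_def using supnorm_nonneg[OF test_fun_dn[OF assms]] by (intro sum_mono2) auto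
  finally have 3: "(1 + \<bar>of_int m\<bar> ^ (k + 2)) * norm (fc f m) \<le> seminorm (k + 2) f"
    using 1 2 by (simp add: algebra_simps)
  define x where "x = \<bar>real_of_int m\<bar>"
  have x: "x \<ge> 0" by (simp add: x_def)
  have "(1 + x) ^ (k + 2) \<le> (2 * max 1 x) ^ (k + 2)"
    using x by (intro power_mono) auto
  also have "\<dots> \<le> 2 ^ (k + 2) * (1 + x ^ (k + 2))"
    using x by (auto simp: max_def power_mult_distrib)
  finally have 4: "(1 + x) ^ (k + 2) \<le> 2 ^ (k + 2) * (1 + x ^ (k + 2))" .
  have "norm (fc f m) * (1 + x) ^ k * (1 + x\<^sup>2) \<le> norm (fc f m) * (1 + x) ^ k * (1 + x)\<^sup>2"
    using x by (intro mult_left_mono) (auto simp: power2_eq_square algebra_simps)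
  also have "\<dots> = norm (fc f m) * (1 + x) ^ (k + 2)"
    by (simp add: power_add power2_eq_square)
  also have "\<dots> \<le> norm (fc f m) * (2 ^ (k + 2) * (1 + x ^ (k + 2)))"
    using 4 by (intro mult_left_mono) auto
  also have "\<dots> = 2 ^ (k + 2) * ((1 + x ^ (k + 2)) * norm (fc f m))"
    by (simp only: mult_ac)
  also have "\<dots> \<le> 2 ^ (k + 2) * seminorm (k + 2) f"
    using 3 unfolding x_def by (intro mult_left_mono) auto
  finally have "norm (fc f m) * (1 + x) ^ k * (1 + x\<^sup>2) \<le> 2 ^ (k + 2) * seminorm (k + 2) f" .
  moreover have "0 < 1 + x\<^sup>2" by (simp add: add_pos_nonneg)
  ultimately have "norm (fc f m) * (1 + x) ^ k \<le> 2 ^ (k + 2) * seminorm (k + 2) f * inverse (1 + x\<^sup>2)"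
    by (simp add: field_simps)
  then show ?thesis unfolding x_def by simp
qed

lemma summable_on_inverse_squares_int: "(\<lambda>m::int. inverse (1 + (of_int m)\<^sup>2) :: real) summable_on UNIV"
proof -
  have s: "summable (\<lambda>n::nat. inverse (1 + (real n)\<^sup>2))"
  proof (rule summable_comparison_test'[OF inverse_power_summable[of 2], of 1])
    show "norm (inverse (1 + (real n)\<^sup>2)) \<le> inverse (real n ^ 2)" if "n \<ge> 1" for n
      using that by (auto intro!: le_imp_inverse_le add_pos_nonneg)
  qed simp
  then have N: "(\<lambda>n::nat. inverse (1 + (real n)\<^sup>2)) summable_on UNIV"
    by (subst summable_on_UNIV_nonneg_real_iff) (auto simp: add_nonneg_nonneg)
  have 1: "(\<lambda>m::int. inverse (1 + (of_int m)\<^sup>2) :: real) summable_on {0..}"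
    using N by (subst summable_on_reindex_bij_witness[where i = int and j = nat and T = UNIV
        and h = "\<lambda>n. inverse (1 + (real n)\<^sup>2)"]) auto
  have 2: "(\<lambda>m::int. inverse (1 + (of_int m)\<^sup>2) :: real) summable_on {..0}"
    using N by (subst summable_on_reindex_bij_witness[where i = "\<lambda>n. - int n" and j = "\<lambda>m. nat (- m)" and T = UNIV
        and h = "\<lambda>n. inverse (1 + (real n)\<^sup>2)"]) auto
  have "{0..} \<union> {..0::int} = UNIV" by auto
  then show ?thesis using summable_on_union[OF 1 2] by simp
qed

lemma fc_summable:
  assumes "test_fun f"
  shows "(\<lambda>m. norm (fc f m) * (1 + \<bar>of_int m\<bar>) ^ k) summable_on UNIV"
proof (rule summable_on_comparison_test)
  show "(\<lambda>m::int. 2 ^ (k + 2) * seminorm (k + 2) f * inverse (1 + (of_int m)\<^sup>2)) summable_on UNIV"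
    by (intro summable_on_cmult_right summable_on_inverse_squares_int)
qed (use fc_decay[OF assms] in auto)

lemma fc_infsum_le:
  assumes "test_fun f"
  shows "(\<Sum>\<^sub>\<infinity>m. norm (fc f m) * (1 + \<bar>of_int m\<bar>) ^ k)
    \<le> 2 ^ (k + 2) * (\<Sum>\<^sub>\<infinity>m::int. inverse (1 + (of_int m)\<^sup>2)) * seminorm (k + 2) f"
proof -
  have "(\<Sum>\<^sub>\<infinity>m. norm (fc f m) * (1 + \<bar>of_int m\<bar>) ^ k)
      \<le> (\<Sum>\<^sub>\<infinity>m::int. 2 ^ (k + 2) * seminorm (k + 2) f * inverse (1 + (of_int m)\<^sup>2))"
    by (intro infsum_mono fc_summable assms summable_on_cmult_right summable_on_inverse_squares_int fc_decay)
  then show ?thesis by (simp add: infsum_cmult_right' mult_ac)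
qed

section \<open>Trigonometric polynomials and uniqueness of Fourier coefficients\<close>

inductive trigpoly :: "(complex \<Rightarrow> real) \<Rightarrow> bool" where
  trigpoly_mono: "trigpoly (\<lambda>z. Re (c * z ^ a * cnj z ^ b))"
| trigpoly_add: "trigpoly f \<Longrightarrow> trigpoly g \<Longrightarrow> trigpoly (\<lambda>z. f z + g z)"

text \<open>The reason why real parts of monomials span an algebra: conjugating the second factor
  only exchanges its exponents of \<open>z\<close> and \<open>cnj z\<close>, so both summands are of
  the same kind again.\<close>

lemma Re_mult_Re: "Re x * Re y = Re (x * y / 2) + Re (x * cnj y / 2)"
  by (simp add: field_simps)

lemma trigpoly_mult_mono: "trigpoly f \<Longrightarrow> trigpoly (\<lambda>z. f z * Re (c * z ^ a * cnj z ^ b))"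
proof (induction rule: trigpoly.induct)
  case (trigpoly_mono c' a' b')
  have "(\<lambda>z. Re (c' * z ^ a' * cnj z ^ b') * Re (c * z ^ a * cnj z ^ b)) =
    (\<lambda>z. Re ((c' * c / 2) * z ^ (a' + a) * cnj z ^ (b' + b)) + Re ((c' * cnj c / 2) * z ^ (a' + b) * cnj z ^ (b' + a)))"
    unfolding Re_mult_Re by (intro ext arg_cong2[of _ _ _ _ "(+)"] arg_cong[of _ _ Re]) (simp_all add: power_add mult_ac)
  then show ?case by (simp only:) (rule trigpoly.trigpoly_add[OF trigpoly.trigpoly_mono trigpoly.trigpoly_mono])
next
  case (trigpoly_add f g)
  then show ?case
    using trigpoly.trigpoly_add[OF trigpoly_add.IH] by (simp add: distrib_right)
qed

lemma trigpoly_mult: "trigpoly f \<Longrightarrow> trigpoly g \<Longrightarrow> trigpoly (\<lambda>z. g z * f z)"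
proof (induction rule: trigpoly.induct)
  case (trigpoly_add f h)
  then show ?case
    using trigpoly.trigpoly_add[OF trigpoly_add.IH] by (simp add: distrib_left)
qed (rule trigpoly_mult_mono)

lemma trigpoly_continuous: "trigpoly f \<Longrightarrow> continuous_on S f"
  by (induction rule: trigpoly.induct) (auto intro!: continuous_intros)

text \<open>Stone-Weierstrass for an algebra of real functions, with \<open>Re\<close> and
  \<open>Im\<close> separating points. The compact set stays free because it is the whole circle in
  the uniqueness proof and the future Kronecker set in \<open>kronecker_setI\<close>.\<close>

lemma trigpoly_dense:
  assumes "compact S" "continuous_on S f" "e > 0"
  shows "\<exists>p. trigpoly p \<and> (\<forall>z\<in>S. \<bar>f z - p z\<bar> < e)"
proof -
  have const: "trigpoly (\<lambda>_. c)" for c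
    using trigpoly_mono[of "of_real c" 0 0] by simp
  have "\<exists>f\<in>Collect trigpoly. f x \<noteq> f y" if "x \<noteq> y" for x y
  proof -
    have "trigpoly Re" "trigpoly Im"
      using trigpoly_mono[of 1 1 0] trigpoly_mono[of "- \<i>" 1 0] by simp_all
    then show ?thesis using that complex_eq_iff by (metis mem_Collect_eq)
  qed
  then interpret function_ring_on "Collect trigpoly" S
    using assms const
    by unfold_locales (auto intro: trigpoly_continuous trigpoly_add trigpoly_mult)
  show ?thesis using Stone_Weierstrass_basic[OF assms(2,3)] by auto
qed

text \<open>Carries periodic functions to the circle so that polynomial approximation applies to
  them. \<open>Arg\<close> jumps on the negative real axis, but the periodicity of \<open>u\<close>
  hides the jump.\<close>

lemma continuous_on_circle_lift:
  fixes u :: "real \<Rightarrow> real"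
  assumes u: "continuous_on UNIV u" and per: "\<And>t. u (t + 2 * pi) = u t"
  shows "continuous_on (sphere 0 1) (\<lambda>z. u (Arg z))" "u (Arg (cis t)) = u t"
proof -
  have eq: "u s = u t" if "cis s = cis t" for s t
  proof -
    have "sin s = sin t \<and> cos s = cos t"
      using that by (metis cis.sel)
    then obtain n :: int where "s = t + 2 * pi * of_int n"
      unfolding sin_cos_eq_iff by blast
    then show ?thesis using periodic_add_int[of u, OF per] by simp
  qed
  show "u (Arg (cis t)) = u t"
    by (rule eq) (simp add: cis_Arg_unique cis_Arg)
  have c: "continuous (at x within S) u" for x S
    using u by (simp add: continuous_on_eq_continuous_at continuous_at_imp_continuous_within)
  show "continuous_on (sphere 0 1) (\<lambda>z. u (Arg z))"
    unfolding continuous_on_eq_continuous_within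
  proof
    fix z :: complex assume z: "z \<in> sphere 0 1"
    show "continuous (at z within sphere 0 1) (\<lambda>z. u (Arg z))"
    proof (cases "z \<in> \<real>\<^sub>\<le>\<^sub>0")
      case False
      then show ?thesis
        using continuous_within_compose[OF continuous_within_Arg c, of z "sphere 0 1"]
        by (simp add: o_def)
    next
      case True
      \<comment> \<open>On the cut, \<open>Arg (- w) + pi\<close> is a continuous substitute for
        \<open>Arg w\<close>, from which it differs by a multiple of 2 pi.\<close>
      have "- z \<notin> \<real>\<^sub>\<le>\<^sub>0"
        using True z by (auto simp: complex_nonpos_Reals_iff cmod_def)
      then have "continuous (at z within sphere 0 1) (\<lambda>z. u (Arg (- z) + pi))"
        using continuous_within_compose[OF continuous_add[OF continuous_within_compose[OF
              continuous_minus[OF continuous_ident] continuous_within_Arg] continuous_const] c,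
            of z "sphere 0 1" pi]
        by (simp add: o_def)
      moreover have "u (Arg (- w) + pi) = u (Arg w)" if "w \<in> sphere 0 1" for w
      proof (rule eq)
        have "w \<noteq> 0" using that by auto
        then show "cis (Arg (- w) + pi) = cis (Arg w)"
          using that by (simp add: cis_mult[symmetric] cis_Arg sgn_div_norm)
      qed
      ultimately show ?thesis
        using z by (auto intro: continuous_transform_within[of z _ _ 1])
    qed
  qed
qed

text \<open>Vanishing coefficients make \<open>u\<close> orthogonal to every trigonometric
  polynomial. Replacing one factor in the integral of \<open>u\<close> squared by
  \<open>u - p\<close>, with \<open>p\<close> uniformly close to \<open>u\<close>, shows that this
  integral is 0.\<close>

lemma real_fourier_unique:
  fixes u :: "real \<Rightarrow> real"
  assumes u: "continuous_on UNIV u" and per: "\<And>t. u (t + 2 * pi) = u t"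
    and fc: "\<And>m. fc (\<lambda>t. of_real (u t)) m = 0"
  shows "u t = 0"
proof -
  have int0: "integral {0..2*pi} (\<lambda>t. of_real (u t) * expi m t) = 0" for m
    using fc[of "- m"] by (simp add: fc_def)
  have cu: "continuous_on S u" for S
    using u continuous_on_subset by blast
  have cc: "continuous_on S (\<lambda>t. f (cis t))" if "trigpoly f" for f S
    using trigpoly_continuous[OF that, of UNIV] by (intro continuous_on_compose2[OF _ continuous_on_cis]) (auto intro: continuous_intros)
  have orth: "integral {0..2*pi} (\<lambda>t. u t * p (cis t)) = 0" if "trigpoly p" for p
    using that
  proof (induction rule: trigpoly.induct)
    case (trigpoly_mono c a b)
    have "(\<lambda>t. u t * Re (c * cis t ^ a * cnj (cis t) ^ b)) = Re \<circ> (\<lambda>t. c * (of_real (u t) * expi (int a - int b) t))"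
      by (simp add: fun_eq_iff Complex.DeMoivre cis_cnj cis_mult expi_cis cis.sel(1) mult_ac right_diff_distrib)
    moreover have "(\<lambda>t. c * (of_real (u t) * expi (int a - int b) t)) integrable_on {0..2*pi}"
      by (intro integrable_continuous_real continuous_intros cu)
    ultimately show ?case
      by (simp only: integral_linear[OF _ bounded_linear_Re]) (simp add: int0)
  next
    case (trigpoly_add f g)
    have "(\<lambda>t. u t * f (cis t)) integrable_on {0..2*pi}" "(\<lambda>t. u t * g (cis t)) integrable_on {0..2*pi}"
      using trigpoly_add by (auto intro!: integrable_continuous_real continuous_intros cu cc)
    then show ?case using trigpoly_add by (simp add: ring_distribs integral_add)
  qed
  have "compact (u ` {0..2*pi})"
    using cu by (intro compact_continuous_image) auto
  then obtain B where B: "\<And>x. x \<in> {0..2*pi} \<Longrightarrow> \<bar>u x\<bar> \<le> B"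
    by (metis bounded_iff compact_imp_bounded imageI real_norm_def)
  have "B \<ge> 0" using B[of 0] by simp
  have "integral {0..2*pi} (\<lambda>t. u t * u t) \<le> e" if "e > 0" for e
  proof -
    define d where "d = e / (2 * pi * (B + 1))"
    have d: "d > 0" using \<open>e > 0\<close> \<open>B \<ge> 0\<close> by (simp add: d_def)
    obtain p where p: "trigpoly p" "\<And>z. z \<in> sphere 0 1 \<Longrightarrow> \<bar>u (Arg z) - p z\<bar> < d"
      using trigpoly_dense[OF compact_sphere continuous_on_circle_lift(1)[OF u per] d] by blast
    have up: "\<bar>u t - p (cis t)\<bar> \<le> d" for t
      using p(2)[of "cis t"] continuous_on_circle_lift(2)[OF u per, of t] by (simp add: less_imp_le)
    have "integral {0..2*pi} (\<lambda>t. u t * u t) = integral {0..2*pi} (\<lambda>t. u t * u t - u t * p (cis t))"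
      using orth[OF p(1)] p(1)
      by (subst integral_diff) (auto intro!: integrable_continuous_real continuous_intros cu cc)
    also have "\<dots> = integral {0..2*pi} (\<lambda>t. u t * (u t - p (cis t)))"
      by (simp add: algebra_simps)
    also have "\<dots> \<le> B * d * (2 * pi - 0)"
    proof (rule order_trans[OF abs_ge_self], unfold real_norm_def[symmetric], rule integral_bound)
      show "norm (u t * (u t - p (cis t))) \<le> B * d" if "t \<in> {0..2*pi}" for t
        using B[OF that] up[of t] \<open>B \<ge> 0\<close> by (simp add: abs_mult mult_mono)
    qed (use p(1) in \<open>auto intro!: continuous_intros cu cc\<close>)
    also have "\<dots> \<le> e"
      using \<open>B \<ge> 0\<close> \<open>e > 0\<close> by (simp add: d_def divide_simps mult_ac)
    finally show ?thesis .
  qed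
  then have "integral {0..2*pi} (\<lambda>t. u t * u t) \<le> 0"
    by (rule field_le_epsilon[of _ 0, simplified])
  moreover have "integral {0..2*pi} (\<lambda>t. u t * u t) \<ge> 0"
    by (intro integral_nonneg integrable_continuous_real continuous_intros cu) auto
  ultimately have "integral {0..2*pi} (\<lambda>t. u t * u t) = 0" by simp
  then have "\<forall>s\<in>{0..2*pi}. u s * u s = 0"
    by (subst (asm) integral_eq_0_iff) (auto intro!: continuous_intros cu)
  moreover obtain s where "s \<in> {0..2*pi}" "u t = u s"
    using reduce_mod_2pi[of t] per by (metis (no_types))
  ultimately show ?thesis by simp
qed

text \<open>The coefficients of the conjugate function are the conjugates of those at the opposite
  index, hence also 0; so real and imaginary parts fall under the real case.\<close>

lemma fourier_unique:
  assumes f: "continuous_on UNIV f" and per: "\<And>t. f (t + 2 * pi) = f t"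
    and fc0: "\<And>m. fc f m = 0"
  shows "f t = 0"
proof -
  have cn: "fc (\<lambda>t. cnj (f t)) m = 0" for m
  proof -
    have "integral {0..2*pi} (\<lambda>t. cnj (f t) * expi (- m) t) = cnj (integral {0..2*pi} (\<lambda>t. f t * expi (- (- m)) t))"
      by (simp add: integral_cnj cnj_expi)
    then show ?thesis using fc0[of "- m"] by (simp add: fc_def)
  qed
  have cc: "continuous_on UNIV (\<lambda>t. cnj (f t))" using f by (intro continuous_intros)
  have R: "(\<lambda>t. complex_of_real (Re (f t))) = (\<lambda>t. (1/2) * (f t + cnj (f t)))"
    by (auto simp: complex_eq_iff)
  have I: "(\<lambda>t. complex_of_real (Im (f t))) = (\<lambda>t. (- \<i>/2) * (f t - cnj (f t)))"
    by (auto simp: complex_eq_iff)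
  have "fc (\<lambda>t. complex_of_real (Re (f t))) m = 0" "fc (\<lambda>t. complex_of_real (Im (f t))) m = 0" for m
    unfolding R I fc_cmult by (simp_all add: fc_add fc_diff f cc cn fc0)
  then have "Re (f t) = 0" "Im (f t) = 0"
    using per f by (intro real_fourier_unique[of "\<lambda>t. Re (f t)"] real_fourier_unique[of "\<lambda>t. Im (f t)"] continuous_intros; simp)+
  then show ?thesis by (simp add: complex_eq_iff)
qed

text \<open>Absolute summability gives uniform convergence to some continuous function. Coefficients
  pass to the uniform limit, so it has the same ones as \<open>f\<close> and equals \<open>f\<close>
  by uniqueness. The limit runs over finite index sets to match \<open>has_sum\<close>.\<close>

lemma fourier_uniform_limit:
  assumes "test_fun f"
  shows "uniform_limit UNIV (\<lambda>F t. \<Sum>m\<in>F. fc f m * expi m t) f (finite_subsets_at_top UNIV)"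
proof -
  define g where "g t = (\<Sum>\<^sub>\<infinity>m. fc f m * expi m t)" for t
  have s: "(\<lambda>m. norm (fc f m)) summable_on UNIV"
    using fc_summable[OF assms, of 0] by simp
  have ul: "uniform_limit UNIV (\<lambda>F t. \<Sum>m\<in>F. fc f m * expi m t) g (finite_subsets_at_top UNIV)"
    unfolding g_def by (rule Weierstrass_m_test_general[OF _ s]) (simp add: norm_mult)
  have cF: "continuous_on UNIV (\<lambda>t. \<Sum>m\<in>F. fc f m * expi m t)" for F
    by (intro continuous_intros)
  have cg: "continuous_on UNIV g"
    by (rule uniform_limit_theorem[OF _ ul]) (use cF in auto)
  have cf: "continuous_on UNIV f"
    using assms test_fun_smooth smooth_fun_continuous by blast
  have fcg: "fc g k = fc f k" for k
  proof (rule tendsto_unique)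
    show "((\<lambda>F. fc (\<lambda>t. \<Sum>m\<in>F. fc f m * expi m t) k) \<longlongrightarrow> fc g k) (finite_subsets_at_top UNIV)"
    proof (rule tendstoI)
      fix e :: real assume "e > 0"
      have "\<forall>\<^sub>F F in finite_subsets_at_top UNIV. \<forall>t\<in>UNIV. dist (\<Sum>m\<in>F. fc f m * expi m t) (g t) < e / 2"
        using uniform_limitD[OF ul, of "e/2"] \<open>e > 0\<close> by simp
      then show "\<forall>\<^sub>F F in finite_subsets_at_top UNIV. dist (fc (\<lambda>t. \<Sum>m\<in>F. fc f m * expi m t) k) (fc g k) < e"
      proof eventually_elim
        case (elim F)
        have "norm (fc (\<lambda>t. (\<Sum>m\<in>F. fc f m * expi m t) - g t) k) \<le> e / 2"
          using elim cF cg by (intro norm_fc_le continuous_intros) (auto simp: dist_norm less_imp_le)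
        then show ?case using \<open>e > 0\<close> by (simp add: fc_diff cF cg dist_norm)
      qed
    qed
    have "\<forall>\<^sub>F F in finite_subsets_at_top UNIV. finite F \<and> k \<in> F"
      unfolding eventually_finite_subsets_at_top by (intro exI[of _ "{k}"]) auto
    then have "\<forall>\<^sub>F F in finite_subsets_at_top UNIV. fc (\<lambda>t. \<Sum>m\<in>F. fc f m * expi m t) k = fc f k"
    proof eventually_elim
      case (elim F)
      then show ?case
        by (subst fc_sum) (auto simp: fc_cmult fc_expi if_distrib sum.delta intro!: continuous_intros cong: if_cong)
    qed
    then show "((\<lambda>F. fc (\<lambda>t. \<Sum>m\<in>F. fc f m * expi m t) k) \<longlongrightarrow> fc f k) (finite_subsets_at_top UNIV)"
      by (rule tendsto_eventually)
  qed auto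
  have "g t - f t = 0" for t
  proof (rule fourier_unique)
    show "g (t + 2 * pi) - f (t + 2 * pi) = g t - f t" for t
      using assms by (simp add: g_def expi_periodic test_fun_iff)
  qed (auto simp: fc_diff cg cf fcg intro!: continuous_intros)
  then have "g = f" by auto
  then show ?thesis using ul by simp
qed

subsection \<open>Distributions\<close>

lemma distribution_add:
  "distribution T \<Longrightarrow> test_fun f \<Longrightarrow> test_fun g \<Longrightarrow> T (\<lambda>t. f t + g t) = T f + T g"
  by (simp add: distribution_def)

lemma distribution_cmult:
  "distribution T \<Longrightarrow> test_fun f \<Longrightarrow> T (\<lambda>t. c * f t) = c * T f"
  by (simp add: distribution_def)

lemma distribution_0: "distribution T \<Longrightarrow> T (\<lambda>t. 0) = 0"
  using distribution_cmult[of T "\<lambda>t. 0" 0] by simp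

lemma distribution_diff:
  assumes "distribution T" "test_fun f" "test_fun g"
  shows "T (\<lambda>t. f t - g t) = T f - T g"
  using distribution_add[OF assms(1,2) test_fun_mult[OF test_fun_const[of "-1"] assms(3)]]
    distribution_cmult[OF assms(1,3), of "-1"] by simp

lemma distribution_sum:
  assumes "distribution T" "finite I" "\<And>i. i \<in> I \<Longrightarrow> test_fun (f i)"
  shows "T (\<lambda>t. \<Sum>i\<in>I. f i t) = (\<Sum>i\<in>I. T (f i))"
  using assms(2,3)
  by (induction I rule: finite_induct) (auto simp: distribution_0[OF assms(1)] distribution_add[OF assms(1)] test_fun_sum)

lemma distribution_bound:
  assumes "distribution T"
  obtains C k where "C \<ge> 0" "\<And>f. test_fun f \<Longrightarrow> norm (T f) \<le> C * seminorm k f"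
proof -
  obtain C k where C: "\<And>f. test_fun f \<Longrightarrow> norm (T f) \<le> C * seminorm k f"
    using assms by (auto simp: distribution_def seminorm_def supnorm_def)
  have "norm (T f) \<le> max C 0 * seminorm k f" if "test_fun f" for f
    using C[OF that] mult_right_mono[OF max.cobounded1[of C 0] seminorm_nonneg[OF that, of k]] by linarith
  then show ?thesis using that[of "max C 0" k] by simp
qed

lemma distributionI:
  assumes "\<And>f g. test_fun f \<Longrightarrow> test_fun g \<Longrightarrow> T (\<lambda>t. f t + g t) = T f + T g"
    and "\<And>f c. test_fun f \<Longrightarrow> T (\<lambda>t. c * f t) = c * T f"
    and "\<And>f. test_fun f \<Longrightarrow> norm (T f) \<le> C * seminorm k f"
  shows "distribution T"
  unfolding distribution_def
  using assms by (auto simp: seminorm_def supnorm_def)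

text \<open>Yields a distribution in the variable of \<open>g\<close>, whose Fourier expansion is
  that of \<open>g\<close> and not of the composed function. This is how the effect of a multiplier
  \<open>g (\<eta> t)\<close> is computed later.\<close>

lemma distribution_mult_compose:
  assumes T: "distribution T" and \<eta>: "smooth_fun (\<lambda>t. complex_of_real (\<eta> t))"
    and per: "\<And>t. \<eta> (t + 2 * pi) = \<eta> t + 2 * pi * of_int n"
    and h: "test_fun h"
  shows "distribution (\<lambda>g. T (\<lambda>t. h t * g (\<eta> t)))"
proof -
  obtain C k where C: "C \<ge> 0" "\<And>f. test_fun f \<Longrightarrow> norm (T f) \<le> C * seminorm k f"
    using distribution_bound[OF T] by blast
  obtain D where D: "\<And>g. test_fun g \<Longrightarrow> seminorm k (\<lambda>t. h t * g (\<eta> t)) \<le> D * seminorm k g"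
    using seminorm_mult_compose[OF \<eta> per h] by blast
  have tf: "test_fun (\<lambda>t. h t * g (\<eta> t))" if "test_fun g" for g
    using test_fun_compose[OF that \<eta> per] h by auto
  show ?thesis
  proof (rule distributionI[where C = "C * D" and k = k])
    fix g assume g: "test_fun g"
    show "norm (T (\<lambda>t. h t * g (\<eta> t))) \<le> C * D * seminorm k g"
      using C(2)[OF tf[OF g]] mult_left_mono[OF D[OF g] C(1)] by (simp add: mult.assoc)
    show "T (\<lambda>t. h t * (c * g (\<eta> t))) = c * T (\<lambda>t. h t * g (\<eta> t))" for c
      using distribution_cmult[OF T tf[OF g], of c] by (simp add: mult_ac)
    show "T (\<lambda>t. h t * (g (\<eta> t) + f (\<eta> t))) = T (\<lambda>t. h t * g (\<eta> t)) + T (\<lambda>t. h t * f (\<eta> t))" if "test_fun f" for f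
      using distribution_add[OF T tf[OF g] tf[OF that]] by (simp add: ring_distribs)
  qed
qed

lemma distribution_mult:
  assumes "distribution T" "test_fun h"
  shows "distribution (\<lambda>g. T (\<lambda>t. h t * g t))"
  using distribution_mult_compose[of T "\<lambda>t. t" 1 h] assms smooth_fun_of_real by simp

text \<open>Fourier sums converge together with all derivatives, since differentiating a partial sum
  of \<open>f\<close> gives the same partial sum for the derivative of \<open>f\<close>. Uniform
  closeness up to an order that bounds \<open>T\<close> is enough.\<close>

lemma distribution_fourier:
  assumes T: "distribution T" and f: "test_fun f"
  shows "((\<lambda>m. fc f m * T (expi m)) has_sum T f) UNIV"
  unfolding has_sum_def
proof (rule tendstoI)
  fix e :: real assume "e > 0"
  obtain C k where C: "C \<ge> 0" "\<And>f. test_fun f \<Longrightarrow> norm (T f) \<le> C * seminorm k f"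
    using distribution_bound[OF T] by blast
  define d where "d = e / (2 * (C + 1) * (real k + 1))"
  have d: "d > 0" using \<open>e > 0\<close> \<open>C \<ge> 0\<close> by (simp add: d_def)
  have "\<forall>\<^sub>F F in finite_subsets_at_top UNIV. \<forall>j\<in>{..k}. \<forall>t\<in>UNIV. dist (\<Sum>m\<in>F. fc (dn j f) m * expi m t) (dn j f t) < d"
    using uniform_limitD[OF fourier_uniform_limit[OF test_fun_dn[OF f]] d]
    by (intro eventually_ball_finite) auto
  moreover have "\<forall>\<^sub>F F in finite_subsets_at_top (UNIV :: int set). finite F"
    by (rule eventually_finite_subsets_at_top_weakI)
  ultimately show "\<forall>\<^sub>F F in finite_subsets_at_top UNIV. dist (\<Sum>m\<in>F. fc f m * T (expi m)) (T f) < e"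
  proof eventually_elim
    case (elim F)
    define p where "p t = (\<Sum>m\<in>F. fc f m * expi m t)" for t
    have p: "test_fun p"
      unfolding p_def[abs_def] by (intro test_fun_sum test_fun_mult test_fun_const test_fun_expi)
    have "T p = (\<Sum>m\<in>F. T (\<lambda>t. fc f m * expi m t))"
      unfolding p_def[abs_def] using elim by (intro distribution_sum T test_fun_mult test_fun_const test_fun_expi) auto
    then have Tp: "T p = (\<Sum>m\<in>F. fc f m * T (expi m))"
      by (simp add: distribution_cmult[OF T])
    have dnp: "dn j p = (\<lambda>t. \<Sum>m\<in>F. fc (dn j f) m * expi m t)" for j
    proof -
      have "finite F \<Longrightarrow> dn j (\<lambda>t. \<Sum>m\<in>F. fc f m * expi m t) = (\<lambda>t. \<Sum>m\<in>F. fc (dn j f) m * expi m t)"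
      proof (induction F rule: finite_induct)
        case empty
        show ?case using dn_cmult[of "\<lambda>t. 0" j 0] by simp
      next
        case (insert m F)
        have "dn j (\<lambda>t. fc f m * expi m t) = (\<lambda>t. fc (dn j f) m * expi m t)"
          by (subst dn_cmult) (simp_all add: test_fun_smooth fc_dn[OF f] dn_expi fun_eq_iff)
        moreover have "test_fun (\<lambda>t. \<Sum>m\<in>F. fc f m * expi m t)" "test_fun (\<lambda>t. fc f m * expi m t)"
          by (intro test_fun_sum test_fun_mult test_fun_const test_fun_expi)+
        ultimately show ?case
          using insert dn_add[OF test_fun_smooth test_fun_smooth] by simp
      qed
      then show ?thesis using elim by (simp add: p_def[abs_def])
    qed
    have "norm (T p - T f) = norm (T (\<lambda>t. p t - f t))"
      by (simp add: distribution_diff[OF T p f])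
    also have "\<dots> \<le> C * seminorm k (\<lambda>t. p t - f t)"
      using p f by (intro C) auto
    also have "\<dots> \<le> C * ((real k + 1) * d)"
    proof (rule mult_left_mono[OF seminorm_le C(1)])
      show "norm (dn j (\<lambda>t. p t - f t) x) \<le> d" if "j \<le> k" for j x
        using elim that by (auto simp: dn_diff[OF test_fun_smooth[OF p] test_fun_smooth[OF f]] dnp dist_norm less_imp_le)
    qed
    also have "\<dots> = C / (C + 1) * (e / 2)"
      by (simp add: d_def divide_simps)
    also have "\<dots> \<le> 1 * (e / 2)"
      using \<open>C \<ge> 0\<close> \<open>e > 0\<close> by (intro mult_right_mono) auto
    also have "\<dots> < e" using \<open>e > 0\<close> by simp
    finally show ?case by (simp add: Tp dist_norm)
  qed
qed

lemma fourier_coeff_expi: "fourier_coeff T m = T (expi (- m))"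
  by (simp add: fourier_coeff_def expi_def[abs_def])

subsection \<open>Peak functions with small nonpositive Fourier coefficients\<close>

lemma power_le_exp:
  fixes y :: real
  assumes "y \<ge> 0"
  shows "y ^ n \<le> real n ^ n * exp y"
proof (cases "n = 0")
  case False
  have "(y / n) ^ n \<le> (1 + y / n) ^ n"
    using assms by (intro power_mono) auto
  also have "\<dots> \<le> exp y"
    using assms False by (intro exp_ge_one_plus_x_over_n_power_n) auto
  finally show ?thesis
    using False by (simp add: power_divide field_simps)
qed (use assms in simp)

text \<open>Only \<open>flat 0\<close>, the classical flat function exp (-1/x), is wanted. The
  division by x^n makes the family closed under differentiation up to linear combinations, which is
  what the induction for smoothness needs.\<close>

definition flat :: "nat \<Rightarrow> real \<Rightarrow> real" where
  "flat n x = (if x > 0 then exp (- (1 / x)) / x ^ n else 0)"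

lemma flat_nonneg: "flat n x \<ge> 0"
  by (simp add: flat_def)

text \<open>This is \<open>power_le_exp\<close> at 1/x with exponent n + 2. Quadratic vanishing at 0
  makes the difference quotients there tend to 0.\<close>

lemma flat_le: "flat n x \<le> real (n + 2) ^ (n + 2) * x\<^sup>2"
proof (cases "x > 0")
  case True
  have "(1 / x) ^ (n + 2) \<le> real (n + 2) ^ (n + 2) * exp (1 / x)"
    using True by (intro power_le_exp) auto
  then have "exp (- (1 / x)) \<le> real (n + 2) ^ (n + 2) * x ^ (n + 2)"
    using True by (simp add: exp_minus power_divide field_simps)
  also have "\<dots> = real (n + 2) ^ (n + 2) * x\<^sup>2 * x ^ n"
    by (simp only: power_add mult_ac)
  finally show ?thesis
    using True by (simp add: flat_def pos_divide_le_eq)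
qed (auto simp: flat_def)

lemma flat_has_derivative:
  "(flat n has_real_derivative flat (n + 2) x - real n * flat (n + 1) x) (at x)"
proof (cases x "0 :: real" rule: linorder_cases)
  case less
  then have "((\<lambda>x. 0) has_real_derivative flat (n + 2) x - real n * flat (n + 1) x) (at x)"
    by (auto simp: flat_def)
  then show ?thesis
    by (rule has_field_derivative_transform_within_open[of _ _ _ "{..<0}"]) (use less in \<open>auto simp: flat_def\<close>)
next
  case greater
  have "((\<lambda>x. exp (- (1 / x)) / x ^ n) has_real_derivative
      (exp (- (1 / x)) * (1 / x\<^sup>2) * x ^ n - exp (- (1 / x)) * (real n * x ^ (n - 1))) / (x ^ n * x ^ n)) (at x)"
    using greater by (auto intro!: derivative_eq_intros simp: power2_eq_square)
  also have "(exp (- (1 / x)) * (1 / x\<^sup>2) * x ^ n - exp (- (1 / x)) * (real n * x ^ (n - 1))) / (x ^ n * x ^ n)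
      = flat (n + 2) x - real n * flat (n + 1) x"
    using greater by (cases n) (simp_all add: flat_def field_simps power2_eq_square)
  finally have "((\<lambda>x. exp (- (1 / x)) / x ^ n) has_real_derivative flat (n + 2) x - real n * flat (n + 1) x) (at x)" .
  then show ?thesis
    by (rule has_field_derivative_transform_within_open[of _ _ _ "{0<..}"]) (use greater in \<open>auto simp: flat_def\<close>)
next
  case equal
  have "((\<lambda>h. flat n h / h) \<longlongrightarrow> 0) (at 0)"
  proof (rule Lim_null_comparison[of _ "\<lambda>h. real (n + 2) ^ (n + 2) * \<bar>h\<bar>"])
    have "\<bar>flat n h / h\<bar> \<le> real (n + 2) ^ (n + 2) * \<bar>h\<bar>" if "h \<noteq> 0" for h
      using flat_le[of n h] flat_nonneg[of n h] that by (simp add: abs_div pos_divide_le_eq power2_eq_square mult_ac)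
    then show "\<forall>\<^sub>F h in at 0. norm (flat n h / h) \<le> real (n + 2) ^ (n + 2) * \<bar>h\<bar>"
      by (auto simp: eventually_at_filter)
    have "((\<lambda>h::real. real (n + 2) ^ (n + 2) * \<bar>h\<bar>) \<longlongrightarrow> real (n + 2) ^ (n + 2) * \<bar>0\<bar>) (at 0)"
      by (intro tendsto_intros)
    then show "((\<lambda>h::real. real (n + 2) ^ (n + 2) * \<bar>h\<bar>) \<longlongrightarrow> 0) (at 0)" by simp
  qed
  then show ?thesis
    using equal by (simp add: DERIV_def) (simp add: flat_def)
qed

lemma smooth_fun_flat: "smooth_fun (\<lambda>x. complex_of_real (flat n x))"
proof -
  have "diff_times j (\<lambda>x. complex_of_real (flat n x))" for j
  proof (induction j arbitrary: n)
    case (Suc j)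
    have "((\<lambda>x. complex_of_real (flat n x)) has_vector_derivative
        of_real (flat (n + 2) x) + of_real (- real n) * of_real (flat (n + 1) x)) (at x)" for x
      using has_vector_derivative_of_real[of "flat n" "flat (n + 2) x - real n * flat (n + 1) x" "at x"]
        flat_has_derivative[of n x] by (simp add: has_real_derivative_iff_has_vector_derivative)
    then show ?case
      by (rule diff_times_SucI) (intro diff_times_add diff_times_mult diff_times_const Suc)
  qed simp
  then show ?thesis by (simp add: smooth_fun_def)
qed

lemma smooth_step:
  obtains st where "smooth_fun st" "\<And>x. x \<le> 0 \<Longrightarrow> st x = 0" "\<And>x. x \<ge> 1 \<Longrightarrow> st x = 1"
proof
  \<comment> \<open>The step function is F(x) / (F(x) + F(1 - x)) with F = \<open>flat 0\<close>;
    the denominator never vanishes because \<open>x\<close> or \<open>1 - x\<close> is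
    positive.\<close>
  let ?d = "\<lambda>x. complex_of_real (flat 0 x) + complex_of_real (flat 0 (1 - x))"
  have pos: "flat 0 x + flat 0 (1 - x) > 0" for x
    by (cases "x > 0") (auto simp: flat_def add_pos_nonneg)
  have nz: "?d x \<noteq> 0" for x
    using pos[of x] by (metis of_real_add of_real_eq_0_iff less_irrefl)
  have "smooth_fun (\<lambda>x. complex_of_real (1 - x))"
    using smooth_fun_diff[OF smooth_fun_const[of 1] smooth_fun_of_real] by simp
  then have "smooth_fun (\<lambda>x. complex_of_real (flat 0 (1 - x)))"
    using smooth_fun_compose[OF smooth_fun_flat[of 0]] by simp
  then show "smooth_fun (\<lambda>x. complex_of_real (flat 0 x) * inverse (?d x))"
    by (intro smooth_fun_mult smooth_fun_inverse smooth_fun_add smooth_fun_flat nz)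
  show "complex_of_real (flat 0 x) * inverse (?d x) = 0" if "x \<le> 0" for x
    using that by (simp add: flat_def)
  show "complex_of_real (flat 0 x) * inverse (?d x) = 1" if "x \<ge> 1" for x
    using that by (simp add: flat_def)
qed

text \<open>A smooth step is applied to an affine function of the cosine, so periodicity is
  automatic. Thresholds are put on cos s because both the distance of \<open>cis s\<close> from 1
  and the real part in \<open>small_polynomial\<close> are read off from it.\<close>

lemma smooth_cutoff:
  assumes "c > 0"
  obtains w where "test_fun w" "\<And>s. cos s \<le> 1 - 4 * c \<Longrightarrow> w s = 1" "\<And>s. w s \<noteq> 0 \<Longrightarrow> cos s \<le> 1 - c"
proof -
  obtain st where st: "smooth_fun st" "\<And>x. x \<le> 0 \<Longrightarrow> st x = 0" "\<And>x. x \<ge> 1 \<Longrightarrow> st x = 1"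
    using smooth_step by blast
  \<comment> \<open>Runs from 0 to 1 while 1 - cos s runs from \<open>c\<close> to
    \<open>4 * c\<close>.\<close>
  define a where "a s = (1 - cos s - c) / (3 * c)" for s
  have "complex_of_real (a s) = (1 - c) / (3 * c) + (- 1 / (6 * c)) * (expi 1 s + expi (- 1) s)" for s
    using assms by (simp add: a_def complex_eq_iff expi_cis field_simps)
  moreover have "smooth_fun (\<lambda>s. of_real ((1 - c) / (3 * c)) + of_real (- 1 / (6 * c)) * (expi 1 s + expi (- 1) s))"
    by (intro smooth_fun_add smooth_fun_mult smooth_fun_const test_fun_smooth test_fun_expi)
  ultimately have "smooth_fun (\<lambda>s. complex_of_real (a s))"
    by simp
  then have "test_fun (\<lambda>s. st (a s))"
    using smooth_fun_compose[OF st(1), of a] by (simp add: test_fun_iff) (simp add: a_def)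
  moreover have "st (a s) = 1" if "cos s \<le> 1 - 4 * c" for s
    using that assms by (intro st) (simp add: a_def)
  moreover have "cos s \<le> 1 - c" if "st (a s) \<noteq> 0" for s
  proof -
    have "a s > 0" using that st(2)[of "a s"] by linarith
    then show ?thesis using assms by (simp add: a_def zero_less_divide_iff)
  qed
  ultimately show ?thesis using that by blast
qed

text \<open>The partial sums of the Poisson kernel minus its mean value have negative real part away
  from \<open>1\<close>; a small multiple of them, added to \<open>1\<close>, has modulus less than \<open>1\<close> there.\<close>
lemma small_polynomial:
  assumes "c > 0"
  obtains p :: "complex poly" and \<rho> :: real
  where "poly p 0 = 1" "0 < \<rho>" "\<rho> < 1" "\<And>z. norm z = 1 \<Longrightarrow> Re z \<le> 1 - c \<Longrightarrow> norm (poly p z) \<le> \<rho>"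
proof -
  \<comment> \<open>With 1 - r at most c/8 the Poisson kernel is at most 1/4 where |1 - r z|^2 is at
    least c, and r at least 1/2 guarantees the latter when Re z is at most 1 - c. \<open>N\<close>
    below makes the tail at most 1/4 as well, so the real part is at most 1/4 - 1 + 1/4.\<close>
  define r where "r = max (1/2) (1 - c / 8)"
  have r: "1/2 \<le> r" "r < 1" "1 - r \<le> c / 8"
    using assms by (simp_all add: r_def) (simp add: max_def)
  have "(\<lambda>N. r ^ N) \<longlonglongrightarrow> 0"
    using r by (intro LIMSEQ_realpow_zero) auto
  then have "\<forall>\<^sub>F N in sequentially. r ^ N < (1 - r) / 8"
    using r by (intro order_tendstoD) auto
  then obtain N0 where N0: "\<And>N. N \<ge> N0 \<Longrightarrow> r ^ N < (1 - r) / 8"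
    by (auto simp: eventually_sequentially)
  define N where "N = N0 + 1"
  have N: "N \<ge> 1" "r ^ (N + 1) \<le> (1 - r) / 8"
    using N0[of "N + 1"] by (auto simp: N_def less_imp_le)
  define q where "q z = (\<Sum>k=1..N. 2 * (of_real r * z) ^ k)" for z :: complex
  have q: "Re (q z) \<le> - 1 / 2" "norm (q z) \<le> 2 * N" if z: "norm z = 1" "Re z \<le> 1 - c" for z
  proof -
    define y where "y = of_real r * z"
    have ny: "norm y = r" using z r by (simp add: y_def norm_mult)
    have y1: "y \<noteq> 1" using ny r by auto
    have ny1: "norm (1 - y) \<ge> 1 - r"
      using norm_triangle_ineq2[of 1 y] ny by simp
    have sq: "(Re z)\<^sup>2 + (Im z)\<^sup>2 = 1"
      using z by (simp add: cmod_def)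
    have "(norm (1 - y))\<^sup>2 = (1 - r * Re z)\<^sup>2 + (r * Im z)\<^sup>2"
      by (simp add: cmod_power2 y_def)
    also have "\<dots> = (1 - r)\<^sup>2 + 2 * r * (1 - Re z) + r\<^sup>2 * ((Re z)\<^sup>2 + (Im z)\<^sup>2 - 1)"
      by (simp add: power2_eq_square algebra_simps)
    also have "\<dots> \<ge> c"
    proof -
      have "c \<le> 2 * r * (1 - Re z)"
        using mult_mono[of 1 "2 * r" c "1 - Re z"] r z assms by simp
      also have "\<dots> \<le> (1 - r)\<^sup>2 + 2 * r * (1 - Re z)" by simp
      finally show ?thesis using sq by simp
    qed
    finally have nc: "(norm (1 - y))\<^sup>2 \<ge> c" .
    have qy: "q z = 2 * ((y - y ^ (N + 1)) / (1 - y))"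
      using sum_gp[of y 1 N] N y1 by (simp add: q_def y_def[symmetric] sum_distrib_left[symmetric])
    \<comment> \<open>The real part of (1 + y) / (1 - y) is the Poisson kernel (1 - |y|^2) / |1 -
      y|^2; the -1 removes its mean value, and the last term is the tail beyond
      \<open>N\<close>.\<close>
    have "q z = (1 + y) / (1 - y) - 1 - 2 * y ^ (N + 1) / (1 - y)"
    proof -
      have "1 - y \<noteq> 0" using y1 by simp
      then have "(1 + y) / (1 - y) - 1 - 2 * Y / (1 - y) = 2 * ((y - Y) / (1 - y))" for Y
        by (simp add: divide_simps)
      then show ?thesis unfolding qy ..
    qed
    moreover have "Re ((1 + y) / (1 - y)) \<le> 1/4"
    proof -
      have "Re ((1 + y) / (1 - y)) = (1 - (norm y)\<^sup>2) / (norm (1 - y))\<^sup>2"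
        unfolding Re_divide' cmod_power2[of y] by (simp add: power2_eq_square algebra_simps)
      also have "\<dots> \<le> (1 - r\<^sup>2) / c"
        using nc assms r by (simp add: ny) (intro divide_left_mono mult_pos_pos, auto simp: power_le_one)
      also have "\<dots> = (1 - r) * (1 + r) / c"
        by (simp add: power2_eq_square algebra_simps)
      also have "\<dots> \<le> (c / 8) * 2 / c"
        using r assms by (intro divide_right_mono mult_mono) auto
      finally show ?thesis using assms by simp
    qed
    moreover have "norm (2 * y ^ (N + 1) / (1 - y)) \<le> 1/4"
    proof -
      have "norm (2 * y ^ (N + 1) / (1 - y)) = 2 * r ^ (N + 1) / norm (1 - y)"
        using r by (simp add: norm_divide norm_mult norm_power ny)
      also have "\<dots> \<le> 2 * ((1 - r) / 8) / (1 - r)"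
        using r N ny1 by (intro frac_le) auto
      also have "\<dots> = 1/4" using r by (simp add: divide_simps)
      finally show ?thesis .
    qed
    ultimately show "Re (q z) \<le> - 1 / 2"
      using abs_Re_le_cmod[of "2 * y ^ (N + 1) / (1 - y)"] by simp
    have "norm (q z) \<le> (\<Sum>k=1..N. 2)"
      unfolding q_def
    proof (rule sum_norm_le)
      show "norm (2 * (of_real r * z) ^ k) \<le> 2" for k
        using ny r power_le_one[of r k] by (simp add: norm_mult norm_power y_def[symmetric])
    qed
    then show "norm (q z) \<le> 2 * N" by simp
  qed
  define B where "B = 2 * real N"
  \<comment> \<open>|1 + \<eta> q|^2 is at most 1 - \<eta> + \<eta>^2 B^2, and this \<eta> makes the
    quadratic term half of the linear one.\<close>
  define \<eta> where "\<eta> = 1 / (2 * B\<^sup>2)"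
  have B: "B \<ge> 2" using N by (simp add: B_def)
  have \<eta>: "\<eta> > 0" using B by (simp add: \<eta>_def)
  define p :: "complex poly" where "p = 1 + smult (of_real \<eta>) (\<Sum>k=1..N. monom (2 * of_real r ^ k) k)"
  have poly_p: "poly p z = 1 + of_real \<eta> * q z" for z
    by (simp add: p_def q_def poly_sum poly_monom power_mult_distrib mult.assoc)
  define \<rho> where "\<rho> = sqrt (1 - \<eta> / 2)"
  have "\<eta> < 1"
  proof -
    have "4 \<le> B\<^sup>2" using B power_mono[of 2 B 2] by simp
    then show ?thesis by (simp add: \<eta>_def divide_simps)
  qed
  then have "0 < \<rho>" "\<rho> < 1" using \<eta> by (auto simp: \<rho>_def)
  moreover have "norm (poly p z) \<le> \<rho>" if z: "norm z = 1" "Re z \<le> 1 - c" for z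
  proof -
    have "(norm (1 + of_real \<eta> * q z))\<^sup>2 = 1 + 2 * \<eta> * Re (q z) + \<eta>\<^sup>2 * (norm (q z))\<^sup>2"
      unfolding cmod_power2 by (simp add: power2_eq_square algebra_simps)
    also have "\<dots> \<le> 1 + 2 * \<eta> * (- 1 / 2) + \<eta>\<^sup>2 * B\<^sup>2"
      using q[OF z] \<eta> by (intro add_mono mult_left_mono power_mono) (auto simp: B_def)
    also have "\<dots> = 1 - \<eta> / 2"
      using B by (simp add: \<eta>_def field_simps power2_eq_square)
    finally show ?thesis
      unfolding poly_p \<rho>_def by (simp add: real_le_rsqrt)
  qed
  moreover have "poly p 0 = 1"
    by (simp add: poly_p q_def power_0_left)
  ultimately show ?thesis using that by blast
qed

lemma poly_cis: "poly p (cis s) = (\<Sum>i\<le>degree p. coeff p i * expi (int i) s)"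
  by (simp add: poly_altdef expi_cis Complex.DeMoivre)

lemma test_fun_poly: "test_fun (\<lambda>s. poly p (cis s))"
  unfolding poly_cis by (intro test_fun_sum test_fun_mult test_fun_const test_fun_expi)

text \<open>Boundary values of polynomials carry only nonnegative frequencies. If the polynomial is
  1 at 0, all its powers thus agree with the constant 1 at every index
  \<open>k \<le> 0\<close>.\<close>

lemma fc_poly:
  assumes "k \<le> 0"
  shows "fc (\<lambda>s. poly p (cis s)) k = (if k = 0 then poly p 0 else 0)"
proof -
  have "fc (\<lambda>s. poly p (cis s)) k = (\<Sum>i\<le>degree p. coeff p i * fc (expi (int i)) k)"
    unfolding poly_cis by (subst fc_sum) (auto simp: fc_cmult intro!: continuous_intros)
  also have "\<dots> = (\<Sum>i\<le>degree p. if i = 0 then (if k = 0 then coeff p i else 0) else 0)"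
    using assms by (intro sum.cong) (auto simp: fc_expi)
  finally show ?thesis by (simp add: poly_0_coeff_0)
qed

lemma power_times_geometric_bounded:
  assumes "0 < \<rho>" "\<rho> < 1"
  shows "\<exists>C. \<forall>M. \<rho> ^ M * (real M + 1) ^ q \<le> C"
proof -
  define l where "l = - ln \<rho>"
  have l: "l > 0" using assms by (simp add: l_def)
  have "\<rho> ^ M * (real M + 1) ^ q \<le> real q ^ q * exp l / l ^ q" for M
  proof -
    have e: "\<rho> ^ M = exp (- (l * M))"
      using assms exp_of_nat_mult[of M "ln \<rho>"] by (simp add: l_def mult.commute)
    have "(l * (real M + 1)) ^ q \<le> real q ^ q * exp (l * (real M + 1))"
      using l by (intro power_le_exp) auto
    also have "\<dots> = real q ^ q * exp l * exp (l * M)"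
      by (simp add: exp_add[symmetric] algebra_simps)
    finally have "(real M + 1) ^ q * l ^ q \<le> real q ^ q * exp l * exp (l * M)"
      by (simp add: power_mult_distrib mult.commute)
    then show ?thesis
      using l unfolding e exp_minus by (simp add: field_simps)
  qed
  then show ?thesis by blast
qed

text \<open>The power of \<open>M\<close> on the left absorbs the factor produced by differentiating \<open>G ^ M\<close>.\<close>
lemma dn_mult_power_bound:
  assumes G: "test_fun G" and \<rho>: "0 < \<rho>" "\<rho> < 1"
  shows "test_fun w \<Longrightarrow> (\<And>s. norm (G s) > \<rho> \<Longrightarrow> w s = 0) \<Longrightarrow>
    \<exists>C. \<forall>M x. norm (dn j (\<lambda>s. w s * G s ^ M) x) * (real M + 1) ^ q \<le> C"
proof (induction j arbitrary: w q)
  case 0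
  obtain C where C: "\<And>M. \<rho> ^ M * (real M + 1) ^ q \<le> C"
    using power_times_geometric_bounded[OF \<rho>] by blast
  have "norm (w x * G x ^ M) * (real M + 1) ^ q \<le> supnorm w * C" for M x
  proof (cases "norm (G x) > \<rho>")
    case True
    have "C \<ge> 0" using C[of 0] by simp
    then show ?thesis using 0 True supnorm_nonneg by auto
  next
    case False
    have "norm (w x * G x ^ M) * (real M + 1) ^ q \<le> supnorm w * \<rho> ^ M * (real M + 1) ^ q"
      using False norm_le_supnorm[OF 0(1)] supnorm_nonneg[OF 0(1)] \<rho> unfolding norm_mult norm_power
      by (intro mult_right_mono mult_mono power_mono) auto
    also have "\<dots> \<le> supnorm w * C"
      using mult_left_mono[OF C[of M] supnorm_nonneg[OF 0(1)]] by (simp add: mult.assoc)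
    finally show ?thesis .
  qed
  then show ?case by auto
next
  case (Suc j)
  obtain w' where w': "\<And>x. (w has_vector_derivative w' x) (at x)" "test_fun w'"
    using test_fun_derivE[OF Suc.prems(1)] by blast
  obtain G' where G': "\<And>x. (G has_vector_derivative G' x) (at x)" "test_fun G'"
    using test_fun_derivE[OF G] by blast
  \<comment> \<open>The set where |G| exceeds \<rho> is open, so the derivative of \<open>w\<close>
    inherits the hypothesis on \<open>w\<close> and the induction applies to it.\<close>
  have w'0: "w' s = 0" if "norm (G s) > \<rho>" for s
  proof -
    have "open {s. norm (G s) > \<rho>}"
      using smooth_fun_continuous[OF test_fun_smooth[OF G]]
      by (intro open_Collect_less continuous_intros) auto
    moreover have "((\<lambda>x. 0) has_vector_derivative 0) (at s)" by simp
    ultimately have "(w has_vector_derivative 0) (at s)"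
      using that Suc.prems(2) has_vector_derivative_transform_within_open[of "\<lambda>x. 0" 0 s "{s. norm (G s) > \<rho>}" w]
      by auto
    then show ?thesis using w'(1) vector_derivative_at by metis
  qed
  obtain C1 where C1: "\<And>M x. norm (dn j (\<lambda>s. w' s * G s ^ M) x) * (real M + 1) ^ q \<le> C1"
    using Suc.IH[OF w'(2) w'0] by blast
  have wG': "test_fun (\<lambda>s. w s * G' s)" using Suc.prems(1) G'(2) by auto
  obtain C2 where C2: "\<And>M x. norm (dn j (\<lambda>s. (w s * G' s) * G s ^ M) x) * (real M + 1) ^ (q + 1) \<le> C2"
    using Suc.IH[OF wG'] Suc.prems(2) by fastforce
  have C12: "C1 \<ge> 0" "C2 \<ge> 0"
    using order_trans[OF _ C1[of 0]] order_trans[OF _ C2[of 0]] by auto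
  define C where "C = supnorm (dn (Suc j) w) + C1 + 2 ^ q * C2"
  have "norm (dn (Suc j) (\<lambda>s. w s * G s ^ M) x) * (real M + 1) ^ q \<le> C" for M x
  proof (cases M)
    case 0
    then have "norm (dn (Suc j) (\<lambda>s. w s * G s ^ M) x) * (real M + 1) ^ q = norm (dn (Suc j) w x)"
      by simp
    moreover have "0 \<le> 2 ^ q * C2" using C12 by simp
    ultimately show ?thesis
      using norm_le_supnorm[OF test_fun_dn[OF Suc.prems(1)], of "Suc j" x] C12
      unfolding C_def by linarith
  next
    case (Suc M')
    have Gp: "((\<lambda>s. G s ^ Suc n) has_vector_derivative of_nat (Suc n) * (G' s * G s ^ n)) (at s)" for n s
    proof (induction n)
      case 0
      show ?case using G' by simp
    next
      case (Suc n)
      show ?case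
        using has_vector_derivative_mult[OF G'(1) Suc] by (simp add: algebra_simps)
    qed
    have "((\<lambda>s. w s * G s ^ M) has_vector_derivative
        w' s * G s ^ M + of_nat M * ((w s * G' s) * G s ^ M')) (at s)" for s
      using has_vector_derivative_mult[OF w'(1) Gp[of M']] unfolding Suc by (simp add: algebra_simps)
    then have "dn (Suc j) (\<lambda>s. w s * G s ^ M) = dn j (\<lambda>s. w' s * G s ^ M + of_nat M * ((w s * G' s) * G s ^ M'))"
      by (rule dn_Suc_eq)
    also have "\<dots> = (\<lambda>x. dn j (\<lambda>s. w' s * G s ^ M) x + of_nat M * dn j (\<lambda>s. (w s * G' s) * G s ^ M') x)"
    proof -
      have t: "test_fun (\<lambda>s. w' s * G s ^ M)" "test_fun (\<lambda>s. (w s * G' s) * G s ^ M')"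
        by (intro test_fun_mult[OF w'(2) test_fun_power[OF G]] test_fun_mult[OF wG' test_fun_power[OF G]])+
      show ?thesis
        using dn_add[OF test_fun_smooth[OF t(1)] smooth_fun_mult[OF smooth_fun_const test_fun_smooth[OF t(2)]], of j "of_nat M"]
          dn_cmult[OF test_fun_smooth[OF t(2)], of j "of_nat M"] by simp
    qed
    finally have eq: "dn (Suc j) (\<lambda>s. w s * G s ^ M) x =
      dn j (\<lambda>s. w' s * G s ^ M) x + of_nat M * dn j (\<lambda>s. (w s * G' s) * G s ^ M') x" by simp
    have "norm (dn (Suc j) (\<lambda>s. w s * G s ^ M) x) * (real M + 1) ^ q
        \<le> norm (dn j (\<lambda>s. w' s * G s ^ M) x) * (real M + 1) ^ q
          + real M * norm (dn j (\<lambda>s. (w s * G' s) * G s ^ M') x) * (real M + 1) ^ q"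
      unfolding eq distrib_right[symmetric]
      by (intro mult_right_mono) (auto intro: order_trans[OF norm_triangle_ineq] simp: norm_mult)
    also have "\<dots> \<le> C1 + 2 ^ q * C2"
    proof (intro add_mono C1)
      \<comment> \<open>M + 1 = M' + 2 is at most twice M' + 1, whence 2^q; the leading factor M =
        M' + 1 raises the exponent to q + 1.\<close>
      have "(real M + 1) ^ q \<le> (2 * (real M' + 1)) ^ q"
        by (intro power_mono) (auto simp: Suc)
      then have "norm (dn j (\<lambda>s. (w s * G' s) * G s ^ M') x) * real M * (real M + 1) ^ q
          \<le> norm (dn j (\<lambda>s. (w s * G' s) * G s ^ M') x) * real M * (2 * (real M' + 1)) ^ q"
        by (intro mult_left_mono) auto
      also have "\<dots> = 2 ^ q * (norm (dn j (\<lambda>s. (w s * G' s) * G s ^ M') x) * (real M' + 1) ^ (q + 1))"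
        unfolding power_mult_distrib Suc by (simp add: mult_ac)
      also have "\<dots> \<le> 2 ^ q * C2"
        by (intro mult_left_mono C2) auto
      finally show "real M * norm (dn j (\<lambda>s. (w s * G' s) * G s ^ M') x) * (real M + 1) ^ q \<le> 2 ^ q * C2"
        by (simp add: mult_ac)
    qed
    also have "\<dots> \<le> C" using supnorm_nonneg[OF test_fun_dn[OF Suc.prems(1)]] by (simp add: C_def)
    finally show ?thesis .
  qed
  then show ?case by blast
qed

text \<open>The witness is (1 - w) p^M on the circle. At nonpositive indices p^M - 1 has no
  coefficients, so only w p^M is seen there. On the support of \<open>w\<close> the polynomial is at
  most \<rho> < 1 in modulus, so w p^M and its derivatives tend to 0 as M grows, while the factor 1
  - w localizes the product.\<close>

lemma peak_function:
  assumes "\<delta> > 0" "\<epsilon> > 0"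
  obtains g where "test_fun g" "\<And>s. g s \<noteq> 0 \<Longrightarrow> norm (cis s - 1) \<le> \<delta>"
    "\<And>k. k \<le> 0 \<Longrightarrow> norm (fc (\<lambda>s. g s - 1) k) * (1 + \<bar>of_int k\<bar>)\<^sup>2 \<le> \<epsilon> * inverse (1 + (of_int k)\<^sup>2)"
proof -
  \<comment> \<open>|cis s - 1|^2 = 2 - 2 cos s, and \<open>w\<close> differs from 1 only where this
    is below 8 c.\<close>
  define c where "c = \<delta>\<^sup>2 / 8"
  have c: "c > 0" using assms by (simp add: c_def)
  obtain w where w: "test_fun w" "\<And>s. cos s \<le> 1 - 4 * c \<Longrightarrow> w s = 1" "\<And>s. w s \<noteq> 0 \<Longrightarrow> cos s \<le> 1 - c"
    using smooth_cutoff[OF c] by blast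
  obtain p :: "complex poly" and \<rho> :: real where p: "poly p 0 = 1" "0 < \<rho>" "\<rho> < 1"
    "\<And>z. norm z = 1 \<Longrightarrow> Re z \<le> 1 - c \<Longrightarrow> norm (poly p z) \<le> \<rho>"
    using small_polynomial[OF c] by metis
  define G where "G s = poly p (cis s)" for s
  have G: "test_fun G" unfolding G_def[abs_def] by (rule test_fun_poly)
  have w0: "w s = 0" if "norm (G s) > \<rho>" for s
    using p(4)[of "cis s"] w(3)[of s] that by (force simp: G_def)
  obtain C where C: "\<And>j M x. norm (dn j (\<lambda>s. w s * G s ^ M) x) * (real M + 1) ^ 1 \<le> C j"
  proof -
    have "\<forall>j. \<exists>C. \<forall>M x. norm (dn j (\<lambda>s. w s * G s ^ M) x) * (real M + 1) ^ 1 \<le> C"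
      by (intro allI dn_mult_power_bound[OF G p(2,3) w(1) w0])
    from choice[OF this] show ?thesis using that by blast
  qed
  define D where "D = (\<Sum>j\<le>4. \<bar>C j\<bar>)"
  \<comment> \<open>\<open>fc_decay\<close> with weight 2 uses four derivatives and costs 2^4 = 16,
    and \<open>seminorm_le\<close> sums five terms; hence 80.\<close>
  obtain M :: nat where M: "80 * D / \<epsilon> \<le> real M"
    using real_arch_simple by blast
  have D: "D \<ge> 0" unfolding D_def by (auto intro: sum_nonneg)
  have wG: "test_fun (\<lambda>s. w s * G s ^ M)" using w G by auto
  have "seminorm 4 (\<lambda>s. w s * G s ^ M) \<le> (real 4 + 1) * (D / (real M + 1))"
  proof (rule seminorm_le)
    fix j x assume "j \<le> (4::nat)"
    then have "\<bar>C j\<bar> \<le> D"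
      unfolding D_def by (intro member_le_sum) auto
    then show "norm (dn j (\<lambda>s. w s * G s ^ M) x) \<le> D / (real M + 1)"
      using C[of j M x] by (simp add: pos_le_divide_eq)
  qed
  also have "\<dots> \<le> \<epsilon> / 16"
    using M D assms by (simp add: field_simps)
  finally have sn: "seminorm 4 (\<lambda>s. w s * G s ^ M) \<le> \<epsilon> / 16" .
  define g where "g s = (1 - w s) * G s ^ M" for s
  have GM: "G s ^ M = poly (p ^ M) (cis s)" for s
    by (simp add: G_def)
  show ?thesis
  proof
    show "test_fun g"
      unfolding g_def[abs_def] by (intro test_fun_mult test_fun_diff test_fun_power test_fun_const w G)
    show "norm (cis s - 1) \<le> \<delta>" if "g s \<noteq> 0" for s
    proof (rule power2_le_imp_le)
      have "w s \<noteq> 1" using that by (auto simp: g_def)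
      then have "cos s > 1 - 4 * c" using w(2) by force
      moreover have "(norm (cis s - 1))\<^sup>2 = 2 - 2 * cos s"
      proof -
        have "(norm (cis s - 1))\<^sup>2 = ((sin s)\<^sup>2 + (cos s)\<^sup>2) + 1 - 2 * cos s"
          unfolding cmod_power2 by (simp add: power2_diff)
        then show ?thesis by simp
      qed
      ultimately show "(norm (cis s - 1))\<^sup>2 \<le> \<delta>\<^sup>2" by (simp add: c_def)
    qed (use assms in simp)
    show "norm (fc (\<lambda>s. g s - 1) k) * (1 + \<bar>of_int k\<bar>)\<^sup>2 \<le> \<epsilon> * inverse (1 + (of_int k)\<^sup>2)"
      if k: "k \<le> 0" for k
    proof -
      have c1: "continuous_on UNIV (\<lambda>s. G s ^ M)" "continuous_on UNIV (\<lambda>s. w s * G s ^ M)"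
        "continuous_on UNIV (expi 0)"
        using test_fun_smooth[OF wG] test_fun_smooth[OF test_fun_power[OF G]] by (auto intro: smooth_fun_continuous continuous_intros)
      have "(\<lambda>s. g s - 1) = (\<lambda>s. (G s ^ M - w s * G s ^ M) - expi 0 s)"
        by (auto simp: g_def algebra_simps)
      then have "fc (\<lambda>s. g s - 1) k = fc (\<lambda>s. G s ^ M) k - fc (\<lambda>s. w s * G s ^ M) k - fc (expi 0) k"
        using c1 by (simp only: fc_diff continuous_on_diff)
      also have "fc (\<lambda>s. G s ^ M) k = fc (expi 0) k"
        using k p(1) unfolding GM fc_poly[OF k] fc_expi by simp
      finally have "fc (\<lambda>s. g s - 1) k = - fc (\<lambda>s. w s * G s ^ M) k" by (simp del: expi_0)
      then have "norm (fc (\<lambda>s. g s - 1) k) = norm (fc (\<lambda>s. w s * G s ^ M) k)" by simp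
      then have "norm (fc (\<lambda>s. g s - 1) k) * (1 + \<bar>of_int k\<bar>)\<^sup>2
          \<le> 2 ^ (2 + 2) * seminorm (2 + 2) (\<lambda>s. w s * G s ^ M) * inverse (1 + (of_int k)\<^sup>2)"
        using fc_decay[OF wG, of k 2] by simp
      also have "\<dots> \<le> \<epsilon> * inverse (1 + (of_int k)\<^sup>2)"
        using sn by (intro mult_right_mono) (auto intro: add_nonneg_nonneg)
      finally show ?thesis .
    qed
  qed
qed

subsection \<open>One step of the construction\<close>

lemma pseudofunction_bounded:
  fixes s :: "int \<Rightarrow> complex"
  assumes "(s \<longlongrightarrow> 0) at_top" "(s \<longlongrightarrow> 0) at_bot"
  obtains B where "\<And>m. norm (s m) \<le> B"
proof -
  have "\<forall>\<^sub>F m in at_top. norm (s m) < 1" "\<forall>\<^sub>F m in at_bot. norm (s m) < 1"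
    using assms tendstoD[of s 0 _ 1] by (auto simp: dist_norm)
  then obtain a b where ab: "\<And>m. m \<ge> a \<Longrightarrow> norm (s m) < 1" "\<And>m. m \<le> b \<Longrightarrow> norm (s m) < 1"
    by (auto simp: eventually_at_top_linorder eventually_at_bot_linorder)
  define B where "B = 1 + (\<Sum>m\<in>{b..a}. norm (s m))"
  have "norm (s m) \<le> B" for m
  proof (cases "m \<in> {b..a}")
    case True
    then have "norm (s m) \<le> (\<Sum>m\<in>{b..a}. norm (s m))"
      by (intro member_le_sum) auto
    then show ?thesis by (simp add: B_def)
  next
    case False
    then have "norm (s m) < 1" using ab by force
    moreover have "(\<Sum>m\<in>{b..a}. norm (s m)) \<ge> 0" by (intro sum_nonneg) auto
    ultimately show ?thesis by (simp add: B_def)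
  qed
  then show ?thesis using that by blast
qed

text \<open>\<open>S (expi m)\<close> is the Fourier coefficient of index \<open>- m\<close>. With
  limits at both ends the reflection is invisible here, but in the one-sided statements below
  \<open>at_top\<close> stands for indices tending to -\<infinity>.\<close>

definition pseudofunction :: "((real \<Rightarrow> complex) \<Rightarrow> complex) \<Rightarrow> bool" where
  "pseudofunction S \<longleftrightarrow> distribution S \<and>
     ((\<lambda>m. S (expi m)) \<longlongrightarrow> 0) at_top \<and> ((\<lambda>m. S (expi m)) \<longlongrightarrow> 0) at_bot"

text \<open>The convolution formula for the coefficients of \<psi> S. The next two lemmas pair the
  summable coefficients of \<psi> with a bounded sequence and with one tending to 0.\<close>

lemma pseudofunction_mult_expi:
  assumes "pseudofunction S" "test_fun \<psi>"
  shows "((\<lambda>j. fc \<psi> j * S (expi (j + l))) has_sum S (\<lambda>t. \<psi> t * expi l t)) UNIV"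
proof -
  have "distribution (\<lambda>g. S (\<lambda>t. expi l t * g t))"
    using assms by (intro distribution_mult) (auto simp: pseudofunction_def)
  from distribution_fourier[OF this assms(2)] show ?thesis
    by (simp add: mult.commute expi_add[symmetric] add.commute)
qed

text \<open>Uniformity in \<open>l\<close> is the point: an arbitrary distribution would allow
  polynomial growth in \<open>l\<close>, while bounded coefficients against the summable
  \<open>fc \<psi>\<close> do not.\<close>

lemma pseudofunction_mult_bound:
  assumes "pseudofunction S"
  obtains C where "C \<ge> 0" "\<And>\<psi> l. test_fun \<psi> \<Longrightarrow> norm (S (\<lambda>t. \<psi> t * expi l t)) \<le> C * seminorm 2 \<psi>"
proof -
  obtain B where B: "\<And>m. norm (S (expi m)) \<le> B"
    using pseudofunction_bounded assms unfolding pseudofunction_def by metis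
  have B0: "B \<ge> 0" using order_trans[OF norm_ge_zero B[of 0]] .
  define D where "D = (\<Sum>\<^sub>\<infinity>m::int. inverse (1 + (of_int m)\<^sup>2) :: real)"
  have D0: "D \<ge> 0" unfolding D_def by (intro infsum_nonneg) auto
  have "norm (S (\<lambda>t. \<psi> t * expi l t)) \<le> (B * 4 * D) * seminorm 2 \<psi>" if \<psi>: "test_fun \<psi>" for \<psi> l
  proof -
    have s: "(\<lambda>j. norm (fc \<psi> j)) summable_on UNIV"
      using fc_summable[OF \<psi>, of 0] by simp
    have "norm (S (\<lambda>t. \<psi> t * expi l t)) \<le> (\<Sum>\<^sub>\<infinity>j. norm (fc \<psi> j)) * B"
    proof (rule norm_infsum_le[OF pseudofunction_mult_expi[OF assms \<psi>]])
      show "((\<lambda>j. norm (fc \<psi> j) * B) has_sum (\<Sum>\<^sub>\<infinity>j. norm (fc \<psi> j)) * B) UNIV"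
        by (intro has_sum_cmult_left has_sum_infsum s)
      show "norm (fc \<psi> j * S (expi (j + l))) \<le> norm (fc \<psi> j) * B" for j
        unfolding norm_mult by (intro mult_left_mono B) auto
    qed
    also have "\<dots> \<le> (4 * D * seminorm 2 \<psi>) * B"
      using fc_infsum_le[OF \<psi>, of 0] B0 unfolding D_def by (intro mult_right_mono) (auto simp: numeral_2_eq_2)
    finally show ?thesis by (simp add: mult_ac)
  qed
  then show ?thesis using that[of "B * 4 * D"] B0 D0 by simp
qed

text \<open>Finitely many \<open>j\<close> carry nearly all the mass of \<open>fc \<psi>\<close>.
  For large |l| these meet only far-out coefficients of \<open>S\<close>, which are small; the
  remaining mass is paired with the bound for all coefficients.\<close>

lemma pseudofunction_mult_small:
  assumes S: "pseudofunction S" and \<psi>: "test_fun \<psi>" and "e > 0"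
  obtains L where "\<And>l. \<bar>l\<bar> \<ge> L \<Longrightarrow> norm (S (\<lambda>t. \<psi> t * expi l t)) \<le> e"
proof -
  obtain B where B: "\<And>m. norm (S (expi m)) \<le> B"
    using pseudofunction_bounded S unfolding pseudofunction_def by metis
  have B0: "B \<ge> 0" using order_trans[OF norm_ge_zero B[of 0]] .
  have s: "(\<lambda>j. norm (fc \<psi> j)) summable_on UNIV"
    using fc_summable[OF \<psi>, of 0] by simp
  define A where "A = (\<Sum>\<^sub>\<infinity>j. norm (fc \<psi> j))"
  have A0: "A \<ge> 0" unfolding A_def by (intro infsum_nonneg) auto
  have "e / (2 * (B + 1)) > 0" using \<open>e > 0\<close> B0 by simp
  from infsum_finite_approximation[OF s this]
  obtain F where F: "finite F" "dist (\<Sum>j\<in>F. norm (fc \<psi> j)) A \<le> e / (2 * (B + 1))"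
    unfolding A_def by blast
  have e': "e / (2 * (A + 1)) > 0" using \<open>e > 0\<close> A0 by simp
  have "\<forall>\<^sub>F m in at_top. norm (S (expi m)) < e / (2 * (A + 1))"
    "\<forall>\<^sub>F m in at_bot. norm (S (expi m)) < e / (2 * (A + 1))"
    using S tendstoD[of "\<lambda>m. S (expi m)" 0 _ "e / (2 * (A + 1))"] e'
    by (auto simp: pseudofunction_def dist_norm)
  then obtain a b where ab: "\<And>m. m \<ge> a \<Longrightarrow> norm (S (expi m)) < e / (2 * (A + 1))"
    "\<And>m. m \<le> b \<Longrightarrow> norm (S (expi m)) < e / (2 * (A + 1))"
    by (auto simp: eventually_at_top_linorder eventually_at_bot_linorder)
  define L where "L = \<bar>a\<bar> + \<bar>b\<bar> + (\<Sum>j\<in>F. \<bar>j\<bar>) + 1"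
  show ?thesis
  proof
    fix l assume l: "\<bar>l\<bar> \<ge> L"
    define q where "q j = (if j \<in> F then norm (fc \<psi> j) * (e / (2 * (A + 1))) else norm (fc \<psi> j) * B)" for j
    have "((\<lambda>j. norm (fc \<psi> j)) has_sum A - (\<Sum>j\<in>F. norm (fc \<psi> j))) (UNIV - F)"
      unfolding A_def using F(1) by (intro has_sum_Diff has_sum_infsum s has_sum_finite) auto
    then have 1: "((\<lambda>j. norm (fc \<psi> j) * B) has_sum (A - (\<Sum>j\<in>F. norm (fc \<psi> j))) * B) (UNIV - F)"
      by (rule has_sum_cmult_left)
    have 2: "((\<lambda>j. norm (fc \<psi> j) * (e / (2 * (A + 1)))) has_sum (\<Sum>j\<in>F. norm (fc \<psi> j)) * (e / (2 * (A + 1)))) F"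
      using F(1) by (intro has_sum_finiteI sum_distrib_right)
    have "(q has_sum ((\<Sum>j\<in>F. norm (fc \<psi> j)) * (e / (2 * (A + 1))) + (A - (\<Sum>j\<in>F. norm (fc \<psi> j))) * B)) (F \<union> (UNIV - F))"
      by (intro has_sum_Un_disjoint has_sum_cong[THEN iffD1, OF _ 1] has_sum_cong[THEN iffD1, OF _ 2]) (auto simp: q_def)
    then have q: "(q has_sum ((\<Sum>j\<in>F. norm (fc \<psi> j)) * (e / (2 * (A + 1))) + (A - (\<Sum>j\<in>F. norm (fc \<psi> j))) * B)) UNIV"
      by simp
    have "norm (fc \<psi> j * S (expi (j + l))) \<le> q j" for j
    proof (cases "j \<in> F")
      case True
      have "\<bar>j\<bar> \<le> (\<Sum>j\<in>F. \<bar>j\<bar>)" using True F(1) by (intro member_le_sum) auto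
      then have "j + l \<ge> a \<or> j + l \<le> b" using l unfolding L_def by linarith
      then have "norm (S (expi (j + l))) \<le> e / (2 * (A + 1))" using ab less_imp_le by blast
      then show ?thesis using True unfolding norm_mult q_def by (simp add: mult_left_mono del: times_divide_eq_right)
    next
      case False
      then show ?thesis unfolding norm_mult q_def using B by (simp add: mult_left_mono)
    qed
    then have "norm (S (\<lambda>t. \<psi> t * expi l t)) \<le> (\<Sum>j\<in>F. norm (fc \<psi> j)) * (e / (2 * (A + 1))) + (A - (\<Sum>j\<in>F. norm (fc \<psi> j))) * B"
      by (intro norm_infsum_le[OF pseudofunction_mult_expi[OF S \<psi>] q])
    also have "\<dots> \<le> A * (e / (2 * (A + 1))) + (e / (2 * (B + 1))) * B"
    proof (intro add_mono mult_right_mono)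
      show "(\<Sum>j\<in>F. norm (fc \<psi> j)) \<le> A"
        unfolding A_def by (intro finite_sum_le_infsum s F) auto
      show "A - (\<Sum>j\<in>F. norm (fc \<psi> j)) \<le> e / (2 * (B + 1))"
        using F(2) by (simp add: dist_real_def)
    qed (use e' B0 in auto)
    also have "\<dots> \<le> e / 2 + e / 2"
    proof (intro add_mono)
      show "A * (e / (2 * (A + 1))) \<le> e / 2"
        using A0 \<open>e > 0\<close> by (simp add: divide_simps)
      show "(e / (2 * (B + 1))) * B \<le> e / 2"
        using B0 \<open>e > 0\<close> by (simp add: divide_simps)
    qed
    finally show "norm (S (\<lambda>t. \<psi> t * expi l t)) \<le> e" by simp
  qed
qed

lemma pseudofunction_mult:
  assumes "pseudofunction S" "test_fun h"
  shows "pseudofunction (\<lambda>g. S (\<lambda>t. h t * g t))"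
  unfolding pseudofunction_def
proof (intro conjI)
  show "distribution (\<lambda>g. S (\<lambda>t. h t * g t))"
    using assms by (intro distribution_mult) (auto simp: pseudofunction_def)
  have *: "\<exists>L. \<forall>l. \<bar>l\<bar> \<ge> L \<longrightarrow> norm (S (\<lambda>t. h t * expi l t)) < e" if "e > 0" for e
    using pseudofunction_mult_small[OF assms, of "e/2"] that by (metis half_gt_zero field_sum_of_halves less_add_same_cancel1 order_le_less_trans)
  show "((\<lambda>m. S (\<lambda>t. h t * expi m t)) \<longlongrightarrow> 0) at_top"
  proof (rule tendstoI)
    fix e :: real assume "e > 0"
    then obtain L where "\<forall>l. \<bar>l\<bar> \<ge> L \<longrightarrow> norm (S (\<lambda>t. h t * expi l t)) < e" using * by blast
    then show "\<forall>\<^sub>F m in at_top. dist (S (\<lambda>t. h t * expi m t)) 0 < e"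
      unfolding eventually_at_top_linorder by (intro exI[of _ L]) auto
  qed
  show "((\<lambda>m. S (\<lambda>t. h t * expi m t)) \<longlongrightarrow> 0) at_bot"
  proof (rule tendstoI)
    fix e :: real assume "e > 0"
    then obtain L where "\<forall>l. \<bar>l\<bar> \<ge> L \<longrightarrow> norm (S (\<lambda>t. h t * expi l t)) < e" using * by blast
    then show "\<forall>\<^sub>F m in at_bot. dist (S (\<lambda>t. h t * expi m t)) 0 < e"
      unfolding eventually_at_bot_linorder by (intro exI[of _ "- L"]) auto
  qed
qed

lemma seminorm_expi_le: "seminorm 2 (expi k) \<le> 3 * (1 + \<bar>of_int k\<bar>)\<^sup>2"
proof -
  have "seminorm 2 (expi k) \<le> (real 2 + 1) * (1 + \<bar>of_int k\<bar>)\<^sup>2"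
  proof (rule seminorm_le)
    fix j x assume "j \<le> (2::nat)"
    have "norm (dn j (expi k) x) = \<bar>of_int k\<bar> ^ j"
      by (simp add: dn_expi norm_mult norm_power)
    also have "\<dots> \<le> (1 + \<bar>of_int k\<bar>) ^ j" by (intro power_mono) auto
    also have "\<dots> \<le> (1 + \<bar>of_int k\<bar>)\<^sup>2" by (intro power_increasing \<open>j \<le> 2\<close>) auto
    finally show "norm (dn j (expi k) x) \<le> (1 + \<bar>of_int k\<bar>)\<^sup>2" .
  qed
  then show ?thesis by simp
qed

text \<open>Writing \<open>f - 1\<close> as \<open>\<Sum>k. a k * expi k (n t - \<phi> t)\<close>, the \<open>k\<close>-th term shifts the Fourier
  coefficients of the pseudofunction \<open>exp (- \<i> k \<phi>) S\<close> by \<open>k n\<close>. The terms with \<open>k \<le> 0\<close> are small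
  since the \<open>a k\<close> are; for those with \<open>k > 0\<close> the shifted coefficients are small up to \<open>n / 2\<close> and
  beyond that only boundedness is needed.\<close>
lemma multiplier_step:
  assumes S: "pseudofunction S" and \<phi>: "smooth_fun (\<lambda>t. complex_of_real (\<phi> t))"
    and per: "\<And>t. \<phi> (t + 2 * pi) = \<phi> t" and "\<delta> > 0" "\<epsilon> > 0"
  obtains n :: nat and f where "n \<ge> 1" "test_fun f"
    "\<And>t. f t \<noteq> 0 \<Longrightarrow> norm (cis t ^ n - cis (\<phi> t)) \<le> \<delta>"
    "\<And>m. norm (S (\<lambda>t. f t * expi m t) - S (expi m)) \<le> \<epsilon> * (1 + \<bar>of_int (min 0 m)\<bar>)"
proof -
  have D: "distribution S" using S by (simp add: pseudofunction_def)
  have m\<phi>: "smooth_fun (\<lambda>t. complex_of_real (- \<phi> t))"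
    using smooth_fun_mult[OF smooth_fun_const[of "-1"] \<phi>] by simp
  have mper: "- \<phi> (t + 2 * pi) = - \<phi> t + 2 * pi * of_int 0" for t
    by (simp add: per)
  define c where "c k l = S (\<lambda>t. expi k (- \<phi> t) * expi l t)" for k l
  have te: "test_fun (\<lambda>t. expi k (- \<phi> t))" for k
    by (rule test_fun_compose[OF test_fun_expi m\<phi> mper])
  obtain C1 where C1: "C1 \<ge> 0" "\<And>\<psi> l. test_fun \<psi> \<Longrightarrow> norm (S (\<lambda>t. \<psi> t * expi l t)) \<le> C1 * seminorm 2 \<psi>"
    using pseudofunction_mult_bound[OF S] by blast
  obtain C2 where C2: "C2 \<ge> 0" "\<And>g. test_fun g \<Longrightarrow> seminorm 2 (\<lambda>t. 1 * g (- \<phi> t)) \<le> C2 * seminorm 2 g"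
    using seminorm_mult_compose[OF m\<phi> mper test_fun_const[of 1], of 2] by blast
  define C where "C = C1 * C2 * 3 + 1"
  have C: "C > 0" using C1 C2 by (simp add: C_def add_nonneg_pos)
  have c_bound: "norm (c k l) \<le> C * (1 + \<bar>of_int k\<bar>)\<^sup>2" for k l
  proof -
    have "norm (c k l) \<le> C1 * seminorm 2 (\<lambda>t. expi k (- \<phi> t))"
      unfolding c_def by (rule C1(2)[OF te])
    also have "\<dots> \<le> C1 * (C2 * (3 * (1 + \<bar>of_int k\<bar>)\<^sup>2))"
      using C2(2)[OF test_fun_expi[of k]] seminorm_expi_le[of k]
      by (intro mult_left_mono[OF order_trans[OF _ mult_left_mono[OF _ C2(1)]]] C1(1)) auto
    also have "\<dots> \<le> C * (1 + \<bar>of_int k\<bar>)\<^sup>2"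
      by (simp add: C_def algebra_simps)
    finally show ?thesis .
  qed
  have c_small: "\<exists>L. \<forall>l. \<bar>l\<bar> \<ge> L \<longrightarrow> norm (c k l) \<le> e" if "e > 0" for k e
    using pseudofunction_mult_small[OF S te that] unfolding c_def by metis
  define D where "D = (\<Sum>\<^sub>\<infinity>k::int. inverse (1 + (of_int k)\<^sup>2) :: real)"
  have D0: "D \<ge> 0" unfolding D_def by (intro infsum_nonneg) auto
  \<comment> \<open>The terms with \<open>k \<le> 0\<close> will add up to at most \<epsilon>' C D,
    which this choice keeps within \<epsilon>/2.\<close>
  define \<epsilon>' where "\<epsilon>' = \<epsilon> / (2 * C * (D + 1))"
  have \<epsilon>': "\<epsilon>' > 0" using \<open>\<epsilon> > 0\<close> C D0 by (simp add: \<epsilon>'_def)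
  obtain g where g: "test_fun g" "\<And>s. g s \<noteq> 0 \<Longrightarrow> norm (cis s - 1) \<le> \<delta>"
    "\<And>k. k \<le> 0 \<Longrightarrow> norm (fc (\<lambda>s. g s - 1) k) * (1 + \<bar>of_int k\<bar>)\<^sup>2 \<le> \<epsilon>' * inverse (1 + (of_int k)\<^sup>2)"
    using peak_function[OF \<open>\<delta> > 0\<close> \<epsilon>'] by blast
  define a where "a k = fc (\<lambda>s. g s - 1) k" for k
  have g1: "test_fun (\<lambda>s. g s - 1)" using g by auto
  \<comment> \<open>A summable majorant of \<open>a k * c k l\<close> independent of
    \<open>l\<close>, hence of \<open>m\<close> and of the \<open>N\<close> still to be
    chosen.\<close>
  define b where "b k = norm (a k) * (C * (1 + \<bar>of_int k\<bar>)\<^sup>2)" for k :: int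
  have b0: "b k \<ge> 0" for k using C by (simp add: b_def)
  have bs: "b summable_on UNIV"
    using summable_on_cmult_right[OF fc_summable[OF g1, of 2], of C]
    unfolding b_def[abs_def] a_def by (simp add: mult_ac)
  have bs': "b summable_on A" for A using bs summable_on_subset by blast
  have b_neg: "infsum b {..0} \<le> \<epsilon> / 2"
  proof -
    have s: "(\<lambda>k::int. (\<epsilon>' * C) * inverse (1 + (of_int k)\<^sup>2)) summable_on UNIV"
      by (intro summable_on_cmult_right summable_on_inverse_squares_int)
    have "infsum b {..0} \<le> infsum (\<lambda>k::int. (\<epsilon>' * C) * inverse (1 + (of_int k)\<^sup>2)) UNIV"
    proof (rule infsum_mono_neutral[OF bs' s])
      show "b k \<le> \<epsilon>' * C * inverse (1 + (real_of_int k)\<^sup>2)" if "k \<in> {..0} \<inter> UNIV" for k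
        using mult_left_mono[OF g(3)[of k], of C] that C by (simp add: b_def a_def mult_ac)
    qed (use \<epsilon>' C in \<open>auto intro!: mult_nonneg_nonneg add_nonneg_nonneg\<close>)
    also have "\<dots> = \<epsilon>' * C * D" by (simp add: infsum_cmult_right' D_def)
    also have "\<dots> = \<epsilon> / 2 * (D / (D + 1))"
      using C by (simp add: \<epsilon>'_def)
    also have "\<dots> \<le> \<epsilon> / 2 * 1"
      using \<open>\<epsilon> > 0\<close> D0 by (intro mult_left_mono) auto
    finally show ?thesis by simp
  qed
  have "\<epsilon> / 8 > 0" using \<open>\<epsilon> > 0\<close> by simp
  from infsum_finite_approximation[OF bs'[of "{1..}"] this]
  obtain F where F: "finite F" "F \<subseteq> {1..}" "dist (sum b F) (infsum b {1..}) \<le> \<epsilon> / 8"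
    by blast
  define A where "A = (\<Sum>k\<in>F. norm (a k)) + 1"
  have A: "A > 0" unfolding A_def by (intro add_nonneg_pos sum_nonneg) auto
  have "\<epsilon> / (8 * A) > 0" using \<open>\<epsilon> > 0\<close> A by simp
  then have "\<forall>k. \<exists>L. \<forall>l. \<bar>l\<bar> \<ge> L \<longrightarrow> norm (c k l) \<le> \<epsilon> / (8 * A)"
    using c_small by blast
  then obtain L where L: "\<And>k l. \<bar>l\<bar> \<ge> L k \<Longrightarrow> norm (c k l) \<le> \<epsilon> / (8 * A)"
    using choice[of "\<lambda>k L. \<forall>l. \<bar>l\<bar> \<ge> L \<longrightarrow> norm (c k l) \<le> \<epsilon> / (8 * A)"] by blast
  \<comment> \<open>The sum puts N/2 above every \<open>L k\<close> with \<open>k\<close> in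
    \<open>F\<close>, for frequencies m from -N/2 upwards. The ceiling makes the whole positive part
    at most N \<epsilon>/4, for the frequencies below.\<close>
  define N where "N = 1 + 2 * (\<Sum>k\<in>F. nat \<bar>L k\<bar>) + nat \<lceil>4 * infsum b {1..} / \<epsilon>\<rceil>"
  have N1: "N \<ge> 1" by (simp add: N_def)
  have NL: "L k \<le> int N div 2" if "k \<in> F" for k
  proof -
    have "nat \<bar>L k\<bar> \<le> (\<Sum>k\<in>F. nat \<bar>L k\<bar>)"
      using that F(1) by (intro member_le_sum) auto
    then have "2 * nat \<bar>L k\<bar> \<le> N" by (simp add: N_def)
    then show ?thesis by linarith
  qed
  have NB: "infsum b {1..} \<le> \<epsilon> / 4 * N"
  proof -
    have "4 * infsum b {1..} / \<epsilon> \<le> real (nat \<lceil>4 * infsum b {1..} / \<epsilon>\<rceil>)"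
      by (rule real_nat_ceiling_ge)
    also have "\<dots> \<le> N" by (simp add: N_def)
    finally show ?thesis using \<open>\<epsilon> > 0\<close> by (simp add: field_simps)
  qed
  define \<eta> where "\<eta> t = real N * t - \<phi> t" for t
  have \<eta>: "smooth_fun (\<lambda>t. complex_of_real (\<eta> t))"
    using smooth_fun_diff[OF smooth_fun_mult[OF smooth_fun_const[of "of_nat N"] smooth_fun_of_real] \<phi>]
    by (simp add: \<eta>_def)
  have \<eta>per: "\<eta> (t + 2 * pi) = \<eta> t + 2 * pi * of_int (int N)" for t
    using per[of t] unfolding \<eta>_def by (simp add: distrib_left)
  define f where "f t = g (\<eta> t)" for t
  have f: "test_fun f" unfolding f_def[abs_def] by (rule test_fun_compose[OF g(1) \<eta> \<eta>per])
  have exp_eq: "expi m t * expi k (\<eta> t) = expi k (- \<phi> t) * expi (int N * k + m) t" for m k t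
    unfolding expi_cis cis_mult \<eta>_def by (simp add: algebra_simps)
  show ?thesis
  proof
    show "N \<ge> 1" "test_fun f" by fact+
    show "norm (cis t ^ N - cis (\<phi> t)) \<le> \<delta>" if "f t \<noteq> 0" for t
    proof -
      have "cis t ^ N - cis (\<phi> t) = cis (\<phi> t) * (cis (\<eta> t) - 1)"
        by (simp add: Complex.DeMoivre \<eta>_def cis_mult right_diff_distrib)
      then have "norm (cis t ^ N - cis (\<phi> t)) = norm (cis (\<eta> t) - 1)"
        by (simp add: norm_mult)
      then show ?thesis using g(2)[of "\<eta> t"] that by (simp add: f_def)
    qed
    show "norm (S (\<lambda>t. f t * expi m t) - S (expi m)) \<le> \<epsilon> * (1 + \<bar>of_int (min 0 m)\<bar>)" for m
    proof -
      have eqs: "(\<lambda>t. expi m t * (f t - 1)) = (\<lambda>t. f t * expi m t - expi m t)"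
        by (auto simp: algebra_simps)
      \<comment> \<open>For fixed \<open>m\<close> the pairing is a distribution in the variable of
        \<open>g\<close>; expanding \<open>g - 1\<close> there produces one term for each frequency
        \<open>k\<close>.\<close>
      have "distribution (\<lambda>g. S (\<lambda>t. expi m t * g (\<eta> t)))"
        by (rule distribution_mult_compose[OF \<open>distribution S\<close> \<eta> \<eta>per test_fun_expi])
      from distribution_fourier[OF this g1]
      have hs: "((\<lambda>k. a k * c k (int N * k + m)) has_sum (S (\<lambda>t. f t * expi m t) - S (expi m))) UNIV"
        using distribution_diff[OF \<open>distribution S\<close> test_fun_mult[OF f test_fun_expi] test_fun_expi, of m m]
        by (simp add: exp_eq c_def a_def f_def[symmetric] eqs)
      have ab: "norm (a k * c k l) \<le> b k" for k l
        unfolding norm_mult b_def by (intro mult_left_mono c_bound) auto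
      define P where "P = infsum (\<lambda>k. norm (a k * c k (int N * k + m))) {1..}"
      have as: "(\<lambda>k. norm (a k * c k (int N * k + m))) summable_on A" for A
        by (rule summable_on_comparison_test[OF bs']) (use ab in auto)

      have un: "{..0} \<union> {1..} = (UNIV :: int set)" by auto
      have "norm (S (\<lambda>t. f t * expi m t) - S (expi m)) \<le> infsum (\<lambda>k. norm (a k * c k (int N * k + m))) ({..0} \<union> {1..})"
        unfolding un by (rule norm_infsum_le[OF hs has_sum_infsum[OF as]]) simp
      also have "\<dots> = infsum (\<lambda>k. norm (a k * c k (int N * k + m))) {..0} + P"
        unfolding P_def by (intro infsum_Un_disjoint as) auto
      also have "\<dots> \<le> infsum b {..0} + P"
        by (intro add_right_mono infsum_mono as bs' ab)
      finally have 1: "norm (S (\<lambda>t. f t * expi m t) - S (expi m)) \<le> \<epsilon> / 2 + P"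
        using b_neg by simp
      have "P \<le> \<epsilon> / 2 * (1 + \<bar>of_int (min 0 m)\<bar>)"
      \<comment> \<open>If -m exceeds N/2, a bound of order N is linear in |m|. Otherwise N k + m is
        at least N/2 for every k from 1 on, so the terms in \<open>F\<close> are small, and those
        outside \<open>F\<close> are negligible by their majorant.\<close>
      proof (cases "2 * (- m) \<le> int N")
        case False
        have "P \<le> infsum b {1..}" unfolding P_def by (intro infsum_mono as bs' ab)
        also have "\<dots> \<le> \<epsilon> / 4 * N" by (rule NB)
        also have "\<dots> \<le> \<epsilon> / 4 * (2 * (1 + \<bar>of_int (min 0 m)\<bar>))"
        proof (rule mult_left_mono)
          have "int N \<le> 2 * (1 + \<bar>min 0 m\<bar>)" using False by simp
          then have "real_of_int (int N) \<le> real_of_int (2 * (1 + \<bar>min 0 m\<bar>))" by (simp only: of_int_le_iff)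
          then show "real N \<le> 2 * (1 + \<bar>of_int (min 0 m)\<bar>)" by simp
        qed (use \<open>\<epsilon> > 0\<close> in auto)
        finally show ?thesis by (simp add: algebra_simps)
      next
        case True
        have Fsplit: "{1..} = F \<union> ({1..} - F)" using F(2) by auto
        have "P = infsum (\<lambda>k. norm (a k * c k (int N * k + m))) F
          + infsum (\<lambda>k. norm (a k * c k (int N * k + m))) ({1..} - F)"
          unfolding P_def by (subst Fsplit, intro infsum_Un_disjoint as) auto
        also have "\<dots> \<le> (\<Sum>k\<in>F. norm (a k) * (\<epsilon> / (8 * A))) + infsum b ({1..} - F)"
        proof (intro add_mono)
          show "infsum (\<lambda>k. norm (a k * c k (int N * k + m))) F \<le> (\<Sum>k\<in>F. norm (a k) * (\<epsilon> / (8 * A)))"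
            unfolding infsum_finite[OF F(1)] norm_mult
          proof (intro sum_mono mult_left_mono L)
            fix k assume k: "k \<in> F"
            then have "k \<ge> 1" using F(2) by auto
            then have "int N * 1 \<le> int N * k" by (intro mult_left_mono) auto
            then show "L k \<le> \<bar>int N * k + m\<bar>" using NL[OF k] True by linarith
          qed auto
          show "infsum (\<lambda>k. norm (a k * c k (int N * k + m))) ({1..} - F) \<le> infsum b ({1..} - F)"
            by (intro infsum_mono as bs' ab)
        qed
        also have "infsum b ({1..} - F) = infsum b {1..} - sum b F"
          using F by (subst infsum_Diff[OF bs' bs']) auto
        also have "\<dots> \<le> \<epsilon> / 8" using F(3) unfolding dist_real_def by linarith
        also have "(\<Sum>k\<in>F. norm (a k) * (\<epsilon> / (8 * A))) = (A - 1) / A * (\<epsilon> / 8)"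
          using A by (simp add: A_def sum_distrib_right[symmetric] sum_divide_distrib[symmetric])
        also have "\<dots> \<le> 1 * (\<epsilon> / 8)"
          using A \<open>\<epsilon> > 0\<close> by (intro mult_right_mono) auto
        finally have "P \<le> \<epsilon> / 2 * 1" using \<open>\<epsilon> > 0\<close> by simp
        also have "\<dots> \<le> \<epsilon> / 2 * (1 + \<bar>of_int (min 0 m)\<bar>)"
          using \<open>\<epsilon> > 0\<close> by (intro mult_left_mono) auto
        finally show ?thesis .
      qed
      moreover have "\<epsilon> / 2 \<le> \<epsilon> / 2 * (1 + \<bar>of_int (min 0 m)\<bar>)"
        using \<open>\<epsilon> > 0\<close> by simp
      moreover have "\<epsilon> / 2 * (1 + \<bar>of_int (min 0 m)\<bar>) + \<epsilon> / 2 * (1 + \<bar>of_int (min 0 m)\<bar>) = \<epsilon> * (1 + \<bar>of_int (min 0 m)\<bar>)"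
        by (simp add: algebra_simps)
      ultimately show ?thesis using 1 by linarith
    qed
  qed
qed

lemma tendsto_uminus_int:
  fixes f :: "int \<Rightarrow> complex"
  shows "(f \<longlongrightarrow> l) at_bot \<Longrightarrow> ((\<lambda>m. f (- m)) \<longlongrightarrow> l) at_top"
    and "(f \<longlongrightarrow> l) at_top \<Longrightarrow> ((\<lambda>m. f (- m)) \<longlongrightarrow> l) at_bot"
proof -
  have "filterlim (\<lambda>m::int. - m) at_bot at_top" "filterlim (\<lambda>m::int. - m) at_top at_bot"
    unfolding filterlim_at_bot filterlim_at_top eventually_at_top_linorder eventually_at_bot_linorder
    by (metis minus_le_iff, metis le_minus_iff)
  then show "(f \<longlongrightarrow> l) at_bot \<Longrightarrow> ((\<lambda>m. f (- m)) \<longlongrightarrow> l) at_top"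
    and "(f \<longlongrightarrow> l) at_top \<Longrightarrow> ((\<lambda>m. f (- m)) \<longlongrightarrow> l) at_bot"
    by (auto intro: filterlim_compose)
qed

subsection \<open>The limit distribution\<close>

lemma pseudofunction_nonzero_coeff:
  assumes "distribution S" "nonzero_distr S"
  obtains m where "S (expi m) \<noteq> 0"
proof -
  obtain \<psi> where \<psi>: "test_fun \<psi>" "S \<psi> \<noteq> 0" using assms by (auto simp: nonzero_distr_def)
  have "\<not> (\<forall>m. S (expi m) = 0)"
  proof
    assume "\<forall>m. S (expi m) = 0"
    then have "((\<lambda>m::int. 0) has_sum S \<psi>) UNIV"
      using distribution_fourier[OF assms(1) \<psi>(1)] by simp
    then show False using \<psi>(2) has_sum_unique[OF has_sum_0_simp, of UNIV "S \<psi>"] by metis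
  qed
  then show ?thesis using that by blast
qed

text \<open>Step j has error at most \<epsilon> 2^(-j) times a weight that is 1 for
  \<open>m \<ge> 0\<close> and grows linearly below. Linear growth is harmless against the
  coefficients of a test function, so the products converge on all of them; the weight 1 makes the
  convergence uniform over \<open>m \<ge> 0\<close>, so that decay survives at that end.\<close>

lemma limit_distribution:
  fixes \<phi> :: "nat \<Rightarrow> real \<Rightarrow> real" and \<delta> :: "nat \<Rightarrow> real"
  assumes S: "pseudofunction S" and nz: "nonzero_distr S"
    and \<phi>: "\<And>j. smooth_fun (\<lambda>t. complex_of_real (\<phi> j t))" "\<And>j t. \<phi> j (t + 2 * pi) = \<phi> j t"
    and \<delta>: "\<And>j. \<delta> j > 0"
  obtains \<mu> and n :: "nat \<Rightarrow> nat" and f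
  where "distribution \<mu>" "nonzero_distr \<mu>" "((\<lambda>m. \<mu> (expi m)) \<longlongrightarrow> 0) at_top" "\<And>j. n j \<ge> 1"
    "\<And>j t. f j t \<noteq> 0 \<Longrightarrow> norm (cis t ^ n j - cis (\<phi> j t)) \<le> \<delta> j"
    "\<And>j. test_fun (f j)"
    "\<And>\<psi>. test_fun \<psi> \<Longrightarrow> (\<lambda>J. S (\<lambda>t. (\<Prod>j<J. f j t) * \<psi> t)) \<longlonglongrightarrow> \<mu> \<psi>"
proof -
  obtain m0 where m0: "S (expi m0) \<noteq> 0"
    using pseudofunction_nonzero_coeff S nz unfolding pseudofunction_def by blast
  define W :: "int \<Rightarrow> real" where "W m = 1 + \<bar>of_int (min 0 m)\<bar>" for m
  have W1: "W m \<ge> 1" for m by (simp add: W_def)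
  \<comment> \<open>All errors at \<open>m0\<close> together are at most 2 \<epsilon>
    \<open>W m0\<close>, half of |S (expi m0)|, so this coefficient stays nonzero in the
    limit.\<close>
  define \<epsilon> where "\<epsilon> = norm (S (expi m0)) / (4 * W m0)"
  have \<epsilon>: "\<epsilon> > 0" using m0 W1[of m0] by (simp add: \<epsilon>_def)
  \<comment> \<open>Relates a product to the one obtained from it by multiplier number
    \<open>j\<close>. Each multiplier is built for the distribution already reached, so the products
    are obtained by dependent choice and the factors are extracted from them afterwards.\<close>
  define R where "R j P Q \<longleftrightarrow> (\<exists>n\<ge>1. \<exists>f. test_fun f \<and> Q = (\<lambda>t. P t * f t) \<and>
      (\<forall>t. f t \<noteq> 0 \<longrightarrow> norm (cis t ^ n - cis (\<phi> j t)) \<le> \<delta> j) \<and>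
      (\<forall>m. norm (S (\<lambda>t. Q t * expi m t) - S (\<lambda>t. P t * expi m t)) \<le> \<epsilon> * (1/2) ^ j * W m))"
    for j :: nat and P Q :: "real \<Rightarrow> complex"
  have "\<exists>P. \<forall>j. test_fun (P j) \<and> (j = 0 \<longrightarrow> P j = (\<lambda>_. 1)) \<and> R j (P j) (P (Suc j))"
  proof -
    have "\<exists>P. \<forall>j. (test_fun (P j) \<and> (j = 0 \<longrightarrow> P j = (\<lambda>_. 1))) \<and> R j (P j) (P (Suc j))"
    proof (rule dependent_nat_choice)
      show "\<exists>P. test_fun P \<and> (0 = (0::nat) \<longrightarrow> P = (\<lambda>_. 1))"
        by (intro exI[of _ "\<lambda>_. 1"]) simp
      fix P :: "real \<Rightarrow> complex" and j :: nat assume P: "test_fun P \<and> (j = 0 \<longrightarrow> P = (\<lambda>_. 1))"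
      have \<epsilon>j: "\<epsilon> * (1/2) ^ j > 0" using \<epsilon> by simp
      obtain n f where nf: "n \<ge> 1" "test_fun f"
        "\<And>t. f t \<noteq> 0 \<Longrightarrow> norm (cis t ^ n - cis (\<phi> j t)) \<le> \<delta> j"
        "\<And>m. norm (S (\<lambda>t. P t * (f t * expi m t)) - S (\<lambda>t. P t * expi m t)) \<le> \<epsilon> * (1/2) ^ j * (1 + \<bar>of_int (min 0 m)\<bar>)"
        using multiplier_step[OF pseudofunction_mult[OF S, of P] \<phi>(1) \<phi>(2) \<delta> \<epsilon>j, of j] P by blast
      have "R j P (\<lambda>t. P t * f t)"
        unfolding R_def W_def using nf by (intro exI[of _ n] conjI exI[of _ f]) (auto simp: mult.assoc)
      then show "\<exists>Q. (test_fun Q \<and> (Suc j = 0 \<longrightarrow> Q = (\<lambda>_. 1))) \<and> R j P Q"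
        using P nf(2) by (intro exI[of _ "\<lambda>t. P t * f t"]) auto
    qed
    then show ?thesis by blast
  qed
  then obtain P where P: "\<And>j. test_fun (P j)" "P 0 = (\<lambda>_. 1)" "\<And>j. R j (P j) (P (Suc j))"
    by blast
  have "\<forall>j. \<exists>nf. fst nf \<ge> 1 \<and> test_fun (snd nf) \<and> P (Suc j) = (\<lambda>t. P j t * snd nf t) \<and>
      (\<forall>t. snd nf t \<noteq> 0 \<longrightarrow> norm (cis t ^ fst nf - cis (\<phi> j t)) \<le> \<delta> j)"
  proof
    fix j
    show "\<exists>nf. fst nf \<ge> 1 \<and> test_fun (snd nf) \<and> P (Suc j) = (\<lambda>t. P j t * snd nf t) \<and>
      (\<forall>t. snd nf t \<noteq> 0 \<longrightarrow> norm (cis t ^ fst nf - cis (\<phi> j t)) \<le> \<delta> j)"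
      using P(3)[of j] unfolding R_def by fastforce
  qed
  from choice[OF this] obtain nf where nf: "\<And>j. fst (nf j) \<ge> (1::nat)" "\<And>j. test_fun (snd (nf j))"
    "\<And>j. P (Suc j) = (\<lambda>t. P j t * snd (nf j) t)"
    "\<And>j t. snd (nf j) t \<noteq> 0 \<Longrightarrow> norm (cis t ^ fst (nf j) - cis (\<phi> j t)) \<le> \<delta> j"
    by blast
  have P_prod: "P J t = (\<Prod>j<J. snd (nf j) t)" for J t
    by (induction J) (simp_all add: P(2) nf(3))
  have diff_coeff: "norm (S (\<lambda>t. P (Suc j) t * expi m t) - S (\<lambda>t. P j t * expi m t)) \<le> \<epsilon> * (1/2) ^ j * W m" for j m
    using P(3)[of j] unfolding R_def by blast
  define T where "T j \<psi> = S (\<lambda>t. P j t * \<psi> t)" for j \<psi>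
  have psT: "pseudofunction (T j)" for j
    unfolding T_def[abs_def] by (rule pseudofunction_mult[OF S P(1)])
  then have dT: "distribution (T j)" for j by (simp add: pseudofunction_def)
  define A where "A \<psi> = (\<Sum>\<^sub>\<infinity>m. norm (fc \<psi> m) * (1 + \<bar>of_int m\<bar>) ^ 1)" for \<psi>
  have As: "(\<lambda>m. norm (fc \<psi> m) * (1 + \<bar>of_int m\<bar>) ^ 1) summable_on UNIV" if "test_fun \<psi>" for \<psi>
    by (rule fc_summable[OF that])
  have diff_T: "norm (T (Suc j) \<psi> - T j \<psi>) \<le> \<epsilon> * (1/2) ^ j * A \<psi>" if \<psi>: "test_fun \<psi>" for j \<psi>
  proof (rule norm_infsum_le)
    show "((\<lambda>m. fc \<psi> m * T (Suc j) (expi m) + - (fc \<psi> m * T j (expi m))) has_sum (T (Suc j) \<psi> - T j \<psi>)) UNIV"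
      using has_sum_add[OF distribution_fourier[OF dT[of "Suc j"] \<psi>] has_sum_uminusI[OF distribution_fourier[OF dT[of j] \<psi>]]]
      by simp
    show "((\<lambda>m. \<epsilon> * (1/2) ^ j * (norm (fc \<psi> m) * (1 + \<bar>of_int m\<bar>) ^ 1)) has_sum \<epsilon> * (1/2) ^ j * A \<psi>) UNIV"
      unfolding A_def by (intro has_sum_cmult_right has_sum_infsum As \<psi>)
    fix m
    have "norm (fc \<psi> m * T (Suc j) (expi m) + - (fc \<psi> m * T j (expi m))) = norm (fc \<psi> m) * norm (T (Suc j) (expi m) - T j (expi m))"
      unfolding norm_mult[symmetric] by (simp add: algebra_simps)
    also have "\<dots> \<le> norm (fc \<psi> m) * (\<epsilon> * (1/2) ^ j * (1 + \<bar>of_int m\<bar>))"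
    proof (rule mult_left_mono[OF order_trans])
      show "norm (T (Suc j) (expi m) - T j (expi m)) \<le> \<epsilon> * (1/2) ^ j * W m"
        unfolding T_def by (rule diff_coeff)
      show "\<epsilon> * (1/2) ^ j * W m \<le> \<epsilon> * (1/2) ^ j * (1 + \<bar>of_int m\<bar>)"
        using \<epsilon> by (intro mult_left_mono) (auto simp: W_def)
    qed auto
    finally show "norm (fc \<psi> m * T (Suc j) (expi m) + - (fc \<psi> m * T j (expi m))) \<le> \<epsilon> * (1/2) ^ j * (norm (fc \<psi> m) * (1 + \<bar>of_int m\<bar>) ^ 1)"
      by (simp add: mult_ac)
  qed
  \<comment> \<open>Stated for scalar sequences because it is applied twice: to a general test
    function, and to exponentials with a sharper constant.\<close>
  have geometric: "\<exists>l. x \<longlonglongrightarrow> l \<and> (\<forall>j::nat. norm (l - x j) \<le> 2 * K * (1/2) ^ j)"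
    if K: "\<And>j. norm (x (Suc j) - x j) \<le> K * (1/2) ^ j" for x :: "nat \<Rightarrow> complex" and K :: real
  proof -
    have *: "norm (x (j + i) - x j) \<le> 2 * K * (1/2) ^ j * (1 - (1/2) ^ i)" for j i
    proof (induction i)
      case (Suc i)
      have "norm (x (j + Suc i) - x j) \<le> norm (x (Suc (j + i)) - x (j + i)) + norm (x (j + i) - x j)"
        using norm_triangle_ineq[of "x (Suc (j + i)) - x (j + i)" "x (j + i) - x j"] by simp
      also have "\<dots> \<le> K * (1/2) ^ (j + i) + 2 * K * (1/2) ^ j * (1 - (1/2) ^ i)"
        by (intro add_mono K Suc)
      also have "\<dots> = 2 * K * (1/2) ^ j * (1 - (1/2) ^ Suc i)"
        by (simp add: power_add algebra_simps)
      finally show ?case .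
    qed simp
    have "summable (\<lambda>j. x (Suc j) - x j)"
      by (rule summable_comparison_test'[OF summable_mult[OF summable_geometric], of "1/2" 0 _ K]) (use K in auto)
    then have "convergent (\<lambda>J. \<Sum>j<J. x (Suc j) - x j)"
      by (simp add: summable_iff_convergent)
    then have "convergent (\<lambda>J. x J - x 0)"
      by (simp add: sum_lessThan_telescope)
    then obtain l' where "(\<lambda>J. x J - x 0) \<longlonglongrightarrow> l'" by (auto simp: convergent_def)
    then have l: "x \<longlonglongrightarrow> l' + x 0" using tendsto_add[OF _ tendsto_const[of "x 0"]] by fastforce
    have "norm (l' + x 0 - x j) \<le> 2 * K * (1/2) ^ j" for j
    proof (rule tendsto_upperbound)
      show "(\<lambda>i. norm (x (i + j) - x j)) \<longlonglongrightarrow> norm (l' + x 0 - x j)"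
        by (intro tendsto_intros LIMSEQ_ignore_initial_segment l)
      have "0 \<le> K" using order_trans[OF norm_ge_zero K[of 0]] by simp
      then have "2 * K * (1/2) ^ j * (1 - (1/2) ^ i) \<le> 2 * K * (1/2) ^ j * 1" for i :: nat
        by (intro mult_left_mono) auto
      then show "\<forall>\<^sub>F i in sequentially. norm (x (i + j) - x j) \<le> 2 * K * (1/2) ^ j"
        using order_trans[OF *[of j]] by (intro always_eventually allI) (simp add: add.commute)
    qed simp
    then show ?thesis using l by blast
  qed
  \<comment> \<open>Outside the test functions \<open>lim\<close> may return an arbitrary value;
    \<open>distribution\<close> constrains test functions only.\<close>
  define \<mu> where "\<mu> \<psi> = lim (\<lambda>j. T j \<psi>)" for \<psi>
  have \<mu>: "(\<lambda>j. T j \<psi>) \<longlonglongrightarrow> \<mu> \<psi>" "norm (\<mu> \<psi> - T 0 \<psi>) \<le> 2 * \<epsilon> * A \<psi>" if \<psi>: "test_fun \<psi>" for \<psi>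
  proof -
    obtain l where l: "(\<lambda>j. T j \<psi>) \<longlonglongrightarrow> l" "\<And>j. norm (l - T j \<psi>) \<le> 2 * (\<epsilon> * A \<psi>) * (1/2) ^ j"
      using geometric[of "\<lambda>j. T j \<psi>" "\<epsilon> * A \<psi>"] diff_T[OF \<psi>] by (auto simp: mult_ac)
    have "\<mu> \<psi> = l" unfolding \<mu>_def using l(1) by (rule limI)
    then show "(\<lambda>j. T j \<psi>) \<longlonglongrightarrow> \<mu> \<psi>" "norm (\<mu> \<psi> - T 0 \<psi>) \<le> 2 * \<epsilon> * A \<psi>"
      using l l(2)[of 0] by simp_all
  qed
  \<comment> \<open>The bound for general test functions would give the factor
    \<open>A (expi m)\<close>, that is 1 + |m|, which is not bounded as \<open>m\<close> grows;
    \<open>W m\<close> stays 1 for \<open>m \<ge> 0\<close>.\<close>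
  have coeff: "norm (\<mu> (expi m) - T j (expi m)) \<le> 2 * (\<epsilon> * W m) * (1/2) ^ j" for m j
  proof -
    obtain l where l: "(\<lambda>j. T j (expi m)) \<longlonglongrightarrow> l" "\<And>j. norm (l - T j (expi m)) \<le> 2 * (\<epsilon> * W m) * (1/2) ^ j"
      using geometric[of "\<lambda>j. T j (expi m)" "\<epsilon> * W m"] diff_coeff by (auto simp: mult_ac T_def)
    then show ?thesis
      using LIMSEQ_unique[OF l(1) \<mu>(1)[OF test_fun_expi]] by simp
  qed
  have T0: "T 0 = S" by (simp add: T_def fun_eq_iff P(2))
  show ?thesis
  proof (rule that[of \<mu> "\<lambda>j. fst (nf j)" "\<lambda>j. snd (nf j)"])
    obtain C k where C: "C \<ge> 0" "\<And>f. test_fun f \<Longrightarrow> norm (S f) \<le> C * seminorm k f"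
      using distribution_bound[of S] S unfolding pseudofunction_def by blast
    define D where "D = (\<Sum>\<^sub>\<infinity>m::int. inverse (1 + (of_int m)\<^sup>2) :: real)"
    have D0: "D \<ge> 0" unfolding D_def by (intro infsum_nonneg) auto
    show "distribution \<mu>"
    \<comment> \<open>\<open>k\<close> serves \<open>S\<close>; the 3 is the weight exponent 1 plus
      the two orders of \<open>fc_decay\<close>, and 16 is 2 times 2^3.\<close>
    proof (rule distributionI[where C = "C + 16 * \<epsilon> * D" and k = "max k 3"])
      fix \<psi> assume \<psi>: "test_fun \<psi>"
      show "\<mu> (\<lambda>t. c * \<psi> t) = c * \<mu> \<psi>" for c
      proof (rule LIMSEQ_unique[OF \<mu>(1)])
        show "(\<lambda>j. T j (\<lambda>t. c * \<psi> t)) \<longlonglongrightarrow> c * \<mu> \<psi>"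
          unfolding distribution_cmult[OF dT \<psi>] by (intro tendsto_intros \<mu> \<psi>)
      qed (use \<psi> in auto)
      show "\<mu> (\<lambda>t. \<psi> t + \<omega> t) = \<mu> \<psi> + \<mu> \<omega>" if \<omega>: "test_fun \<omega>" for \<omega>
      proof (rule LIMSEQ_unique[OF \<mu>(1)])
        show "(\<lambda>j. T j (\<lambda>t. \<psi> t + \<omega> t)) \<longlonglongrightarrow> \<mu> \<psi> + \<mu> \<omega>"
          unfolding distribution_add[OF dT \<psi> \<omega>] by (intro tendsto_intros \<mu> \<psi> \<omega>)
      qed (use \<psi> \<omega> in auto)
      have A3: "A \<psi> \<le> 8 * D * seminorm 3 \<psi>"
        using fc_infsum_le[OF \<psi>, of 1] unfolding A_def D_def by (simp add: numeral_3_eq_3)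
      have "norm (\<mu> \<psi>) \<le> norm (S \<psi>) + norm (\<mu> \<psi> - S \<psi>)"
        using norm_triangle_sub by blast
      also have "\<dots> \<le> C * seminorm k \<psi> + 2 * \<epsilon> * (8 * D * seminorm 3 \<psi>)"
        using C(2)[OF \<psi>] order_trans[OF \<mu>(2)[OF \<psi>, unfolded T0] mult_left_mono[OF A3]] \<epsilon>
        by (intro add_mono) auto
      also have "\<dots> \<le> C * seminorm (max k 3) \<psi> + 2 * \<epsilon> * (8 * D * seminorm (max k 3) \<psi>)"
        using \<epsilon> C(1) D0 seminorm_mono[OF \<psi>] by (intro add_mono mult_left_mono) auto
      finally show "norm (\<mu> \<psi>) \<le> (C + 16 * \<epsilon> * D) * seminorm (max k 3) \<psi>"
        by (simp add: algebra_simps)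
    qed
    have "\<mu> (expi m0) \<noteq> 0"
    proof
      assume "\<mu> (expi m0) = 0"
      then have "norm (S (expi m0)) \<le> 2 * (\<epsilon> * W m0)"
        using coeff[of m0 0] T0 by simp
      also have "\<dots> = norm (S (expi m0)) / 2"
        using W1[of m0] by (simp add: \<epsilon>_def)
      finally show False using m0 by simp
    qed
    then show "nonzero_distr \<mu>" unfolding nonzero_distr_def using test_fun_expi by blast
    show "((\<lambda>m. \<mu> (expi m)) \<longlongrightarrow> 0) at_top"
    proof (rule tendstoI)
      fix e :: real assume "e > 0"
      have "(\<lambda>j. 2 * \<epsilon> * (1/2) ^ j) \<longlonglongrightarrow> 2 * \<epsilon> * 0"
        by (intro tendsto_intros LIMSEQ_realpow_zero) auto
      then have "\<forall>\<^sub>F j in sequentially. 2 * \<epsilon> * (1/2) ^ j < e / 2"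
        using \<open>e > 0\<close> by (intro order_tendstoD) auto
      then obtain j where j: "2 * \<epsilon> * (1/2) ^ j < e / 2"
        by (auto simp: eventually_sequentially)
      have "((\<lambda>m. T j (expi m)) \<longlongrightarrow> 0) at_top" using psT[of j] by (simp add: pseudofunction_def)
      then have "\<forall>\<^sub>F m in at_top. dist (T j (expi m)) 0 < e / 2"
        using \<open>e > 0\<close> by (intro tendstoD) auto
      then show "\<forall>\<^sub>F m in at_top. dist (\<mu> (expi m)) 0 < e"
        using eventually_ge_at_top[of 0]
      proof eventually_elim
        case (elim m)
        have "norm (\<mu> (expi m) - T j (expi m)) < e / 2"
          using coeff[of m j] j elim by (simp add: W_def)
        then show ?case
          using elim norm_triangle_sub[of "\<mu> (expi m)" "T j (expi m)"] by simp
      qed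
    qed
    show "(\<lambda>J. S (\<lambda>t. (\<Prod>j<J. snd (nf j) t) * \<psi> t)) \<longlonglongrightarrow> \<mu> \<psi>" if "test_fun \<psi>" for \<psi>
      using \<mu>(1)[OF that] unfolding T_def P_prod .
  qed (use nf in auto)
qed

subsection \<open>Supports\<close>

lemma closed_circ: "closed circ"
  by (simp add: circ_def)

lemma closed_distr_support: "closed (distr_support T)"
proof -
  have "closed (circ - \<Union>{U. open U \<and> (\<forall>\<phi>. test_fun \<phi> \<and> cis ` closure {t. \<phi> t \<noteq> 0} \<subseteq> U \<longrightarrow> T \<phi> = 0)})"
    by (intro closed_Diff closed_circ open_Union) auto
  also have "circ - \<Union>{U. open U \<and> (\<forall>\<phi>. test_fun \<phi> \<and> cis ` closure {t. \<phi> t \<noteq> 0} \<subseteq> U \<longrightarrow> T \<phi> = 0)}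
      = distr_support T"
    unfolding distr_support_def by blast
  finally show ?thesis .
qed

lemma notin_distr_supportI:
  assumes "open U" "z \<in> U" "\<And>\<phi>. test_fun \<phi> \<Longrightarrow> cis ` closure {t. \<phi> t \<noteq> 0} \<subseteq> U \<Longrightarrow> T \<phi> = 0"
  shows "z \<notin> distr_support T"
  unfolding distr_support_def using assms by blast

lemma cis_image_closure_notin:
  assumes "cis ` closure {t. \<psi> t \<noteq> 0} \<subseteq> U" "cis t \<notin> U"
  shows "\<psi> t = 0"
  using assms closure_subset by fastforce

subsection \<open>Approximation by powers\<close>

text \<open>The condition of \<open>kronecker_set\<close> for one function, separated from
  continuity so that closure under products, conjugates and uniform limits can be stated.\<close>

definition approximable :: "complex set \<Rightarrow> (complex \<Rightarrow> complex) \<Rightarrow> bool" where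
  "approximable K u \<longleftrightarrow> (\<forall>e>0. \<exists>n::int. \<forall>z\<in>K. norm (u z - z powi n) < e)"

lemma approximable_mult:
  assumes K: "K \<subseteq> circ" and u: "\<And>z. z \<in> K \<Longrightarrow> norm (u z) = 1"
    and "approximable K u" "approximable K v"
  shows "approximable K (\<lambda>z. u z * v z)"
  unfolding approximable_def
proof (intro allI impI)
  fix e :: real assume "e > 0"
  obtain n where n: "\<And>z. z \<in> K \<Longrightarrow> norm (u z - z powi n) < e / 2"
    using assms(3) \<open>e > 0\<close> unfolding approximable_def by (meson half_gt_zero)
  obtain m where m: "\<And>z. z \<in> K \<Longrightarrow> norm (v z - z powi m) < e / 2"
    using assms(4) \<open>e > 0\<close> unfolding approximable_def by (meson half_gt_zero)
  have "norm (u z * v z - z powi (n + m)) < e" if z: "z \<in> K" for z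
  proof -
    have nz: "norm z = 1" using K z by (auto simp: circ_def)
    then have "z \<noteq> 0" by auto
    then have "u z * v z - z powi (n + m) = u z * (v z - z powi m) + (u z - z powi n) * z powi m"
      by (simp add: power_int_add algebra_simps)
    also have "norm \<dots> \<le> norm (v z - z powi m) + norm (u z - z powi n)"
      using u[OF z] nz by (intro norm_triangle_le) (simp add: norm_mult norm_power_int)
    finally show ?thesis using n[OF z] m[OF z] by simp
  qed
  then show "\<exists>n::int. \<forall>z\<in>K. norm (u z * v z - z powi n) < e" by blast
qed

lemma approximable_cnj:
  assumes K: "K \<subseteq> circ" and "approximable K u"
  shows "approximable K (\<lambda>z. cnj (u z))"
  unfolding approximable_def
proof (intro allI impI)
  fix e :: real assume "e > 0"
  then obtain n where n: "\<And>z. z \<in> K \<Longrightarrow> norm (u z - z powi n) < e"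
    using assms(2) unfolding approximable_def by blast
  have "norm (cnj (u z) - z powi (- n)) < e" if z: "z \<in> K" for z
  proof -
    have nz: "norm z = 1" using K z by (auto simp: circ_def)
    then have "norm (z powi n) = 1" by (simp add: norm_power_int)
    then have "inverse (z powi n) = cnj (z powi n)"
      by (metis complex_norm_square inverse_unique of_real_1 power_one)
    then have "z powi (- n) = cnj (z powi n)"
      by (simp add: power_int_minus)
    then have "norm (cnj (u z) - z powi (- n)) = norm (cnj (u z - z powi n))" by simp
    then show ?thesis using n[OF z] by (simp only: complex_mod_cnj)
  qed
  then show "\<exists>n::int. \<forall>z\<in>K. norm (cnj (u z) - z powi n) < e" by blast
qed

lemma approximable_limit:
  assumes "\<And>e. e > 0 \<Longrightarrow> \<exists>v. approximable K v \<and> (\<forall>z\<in>K. norm (u z - v z) \<le> e)"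
  shows "approximable K u"
  unfolding approximable_def
proof (intro allI impI)
  fix e :: real assume "e > 0"
  then obtain v where v: "approximable K v" "\<And>z. z \<in> K \<Longrightarrow> norm (u z - v z) \<le> e / 2"
    using assms[of "e/2"] by auto
  obtain n where n: "\<And>z. z \<in> K \<Longrightarrow> norm (v z - z powi n) < e / 2"
    using v(1) \<open>e > 0\<close> unfolding approximable_def by (meson half_gt_zero)
  have "norm (u z - z powi n) < e" if "z \<in> K" for z
    using norm_triangle_ineq[of "u z - v z" "v z - z powi n"] v(2)[OF that] n[OF that] by simp
  then show "\<exists>n::int. \<forall>z\<in>K. norm (u z - z powi n) < e" by blast
qed

lemma norm_cis_diff_le: "norm (cis a - cis b) \<le> \<bar>a - b\<bar>"
proof -
  have "norm (cis a - cis b) = norm (cis b * (cis (a - b) - 1))"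
    by (simp add: cis_mult right_diff_distrib)
  also have "\<dots> = norm (exp (\<i> * of_real (a - b)) - 1)"
    by (simp add: norm_mult cis_conv_exp)
  also have "\<dots> = 2 * \<bar>sin ((a - b) / 2)\<bar>"
    by (metis dist_exp_i_1 dist_norm)
  also have "\<dots> \<le> \<bar>a - b\<bar>"
    using abs_sin_x_le_abs_x[of "(a - b) / 2"] by simp
  finally show ?thesis .
qed

text \<open>The family in \<open>gen\<close> is countable, so a sequence of multiplier steps can
  serve it. Integer multiples and limits extend it to all real multiples, sums to trigonometric
  polynomials, and density to every continuous real phase; a continuous logarithm writes any
  unimodular function by such a phase.\<close>

lemma kronecker_setI:
  assumes "closed K" "K \<subseteq> circ" "K \<noteq> circ"
    and gen: "\<And>\<kappa> a b q. \<kappa> \<in> {1, \<i>} \<Longrightarrow> approximable K (\<lambda>z. cis (Re (\<kappa> * z ^ a * cnj z ^ b) / real (Suc q)))"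
  shows "kronecker_set K"
proof -
  \<comment> \<open>Demanding every real multiple makes closure under scaling automatic.\<close>
  define V where "V = {\<phi> :: complex \<Rightarrow> real. \<forall>c::real. approximable K (\<lambda>z. cis (c * \<phi> z))}"
  have nK: "norm z = 1" if "z \<in> K" for z using that assms(2) by (auto simp: circ_def)
  have Vadd: "(\<lambda>z. \<phi> z + \<psi> z) \<in> V" if "\<phi> \<in> V" "\<psi> \<in> V" for \<phi> \<psi>
    using that approximable_mult[OF assms(2), of "\<lambda>z. cis (_ * \<phi> z)" "\<lambda>z. cis (_ * \<psi> z)"]
    by (simp add: V_def ring_distribs cis_mult)
  have Vscale: "(\<lambda>z. c * \<phi> z) \<in> V" if "\<phi> \<in> V" for c \<phi>
    using that by (simp add: V_def mult.assoc[symmetric])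
  have Vgen: "(\<lambda>z. Re (\<kappa> * z ^ a * cnj z ^ b)) \<in> V" if \<kappa>: "\<kappa> \<in> {1, \<i>}" for \<kappa> a b
    unfolding V_def
  proof (intro CollectI allI approximable_limit)
    fix c e :: real assume "e > 0"
    define \<phi> where "\<phi> z = Re (\<kappa> * z ^ a * cnj z ^ b)" for z
    have \<phi>1: "\<bar>\<phi> z\<bar> \<le> 1" if "z \<in> K" for z
    proof -
      have "\<bar>\<phi> z\<bar> \<le> norm (\<kappa> * z ^ a * cnj z ^ b)" unfolding \<phi>_def by (rule abs_Re_le_cmod)
      also have "\<dots> = 1" using \<kappa> nK[OF that] by (auto simp: norm_mult norm_power)
      finally show ?thesis .
    qed
    obtain q :: nat where q: "1 / e \<le> real q" using real_arch_simple by blast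
    \<comment> \<open>k / (q + 1) is within 1 / (q + 1) of \<open>c\<close>, and the phase is at
      most 1 in modulus on \<open>K\<close>.\<close>
    define k where "k = \<lfloor>c * real (Suc q)\<rfloor>"
    have nat_mult: "approximable K (\<lambda>z. cis (real i * (\<phi> z / real (Suc q))))" for i
    proof (induction i)
      case 0
      have "approximable K (\<lambda>z. z powi 0)" unfolding approximable_def by (metis diff_self norm_zero)
      then show ?case by simp
    next
      case (Suc i)
      have "approximable K (\<lambda>z. cis (\<phi> z / real (Suc q)))" unfolding \<phi>_def by (rule gen[OF \<kappa>])
      from approximable_mult[OF assms(2) _ this Suc] show ?case
        by (simp add: cis_mult ring_distribs add_divide_distrib add.commute)
    qed
    have kq: "approximable K (\<lambda>z. cis (of_int k * (\<phi> z / real (Suc q))))"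
    proof (cases "k \<ge> 0")
      case True
      then show ?thesis using nat_mult[of "nat k"] by simp
    next
      case False
      then show ?thesis
        using approximable_cnj[OF assms(2) nat_mult[of "nat (- k)"]] by (simp add: cis_cnj)
    qed
    have "norm (cis (c * \<phi> z) - cis (of_int k * (\<phi> z / real (Suc q)))) \<le> e" if z: "z \<in> K" for z
    proof -
      have "\<bar>c * real (Suc q) - of_int k\<bar> \<le> 1" unfolding k_def by linarith
      moreover have "c * \<phi> z - of_int k * (\<phi> z / real (Suc q)) = (c * real (Suc q) - of_int k) * \<phi> z / real (Suc q)"
        by (simp add: field_simps)
      moreover have "\<bar>(c * real (Suc q) - of_int k) * \<phi> z / real (Suc q)\<bar>
          = \<bar>c * real (Suc q) - of_int k\<bar> * \<bar>\<phi> z\<bar> / real (Suc q)"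
        by (simp only: abs_mult abs_divide abs_of_nat)
      ultimately have "\<bar>c * \<phi> z - of_int k * (\<phi> z / real (Suc q))\<bar> \<le> 1 * 1 / real (Suc q)"
        using \<phi>1[OF z] by (simp only:) (intro divide_right_mono mult_mono, auto)
      also have "\<dots> \<le> e" using q \<open>e > 0\<close> by (simp add: field_simps)
      finally show ?thesis using norm_cis_diff_le order_trans by blast
    qed
    then show "\<exists>v. approximable K v \<and> (\<forall>z\<in>K. norm (cis (c * Re (\<kappa> * z ^ a * cnj z ^ b)) - v z) \<le> e)"
      using kq unfolding \<phi>_def by blast
  qed
  have Vtrig: "p \<in> V" if "trigpoly p" for p
    using that
  proof (induction rule: trigpoly.induct)
    case (trigpoly_mono c a b)
    have "(\<lambda>z. Re (c * z ^ a * cnj z ^ b)) = (\<lambda>z. Re c * Re (1 * z ^ a * cnj z ^ b) + Im c * Re (\<i> * z ^ a * cnj z ^ b))"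
    proof
      fix z
      \<comment> \<open>As Re (\<i> w) = - Im w, the two values of \<kappa> generate all complex
        coefficients.\<close>
      have "Re (c * w) = Re c * Re (1 * w) + Im c * Re (\<i> * w)" for w by simp
      from this[of "z ^ a * cnj z ^ b"]
      show "Re (c * z ^ a * cnj z ^ b) = Re c * Re (1 * z ^ a * cnj z ^ b) + Im c * Re (\<i> * z ^ a * cnj z ^ b)"
        by (simp only: mult.assoc)
    qed
    moreover have "\<dots> \<in> V" by (intro Vadd Vscale Vgen) auto
    ultimately show ?case by (simp only:)
  next
    case (trigpoly_add f g)
    then show ?case by (intro Vadd)
  qed
  have compK: "compact K"
    using assms(1,2) compact_sphere[of "0::complex" 1] closed_Int_compact[of K circ]
    by (simp add: circ_def Int_absorb2)
  have "connected (- K)"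
  proof -
    \<comment> \<open>Open disc and exterior joined through a point of the circle missing from
      \<open>K\<close>. These connected sets share 0 and fill the complement of \<open>K\<close>;
      for a compact plane set, a connected complement is what provides continuous logarithms of
      circle-valued maps.\<close>
    define C where "C w = insert w (ball 0 1) \<union> insert w {z. norm z > 1}" for w :: complex
    have C: "connected (C w)" if w: "norm w = 1" for w
    proof -
      have 1: "connected (insert w (ball 0 1))"
      proof (rule connected_intermediate_closure[of "ball 0 1"])
        show "insert w (ball 0 1) \<subseteq> closure (ball 0 (1::real))" using w by (auto simp: closure_ball)
      qed auto
      have 2: "connected (insert w {z. norm z > 1})"
      proof (rule connected_intermediate_closure[of "{z. norm z > 1}"])
        show "connected {z::complex. norm z > 1}"
        proof -
          have "- cball (0::complex) 1 = {z. norm z > 1}" by auto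
          then show ?thesis
            using connected_complement_bounded_convex[OF bounded_cball convex_cball, of "0::complex" 1] by simp
        qed
        have "w \<in> closure {z. norm z > 1}"
          unfolding closure_approachable
        proof (intro allI impI)
          fix e :: real assume "e > 0"
          have "norm (of_real (1 + e / 2) * w) = \<bar>1 + e / 2\<bar>"
            by (simp only: norm_mult norm_of_real w mult_1_right)
          moreover have "of_real (1 + e / 2) * w - w = of_real (e / 2) * w"
            by (simp only: of_real_add of_real_1 distrib_right mult_1_left add_diff_cancel_left')
          then have "norm (of_real (1 + e / 2) * w - w) = \<bar>e / 2\<bar>"
            by (simp only: norm_mult norm_of_real w mult_1_right)
          ultimately have "norm (of_real (1 + e / 2) * w) > 1" "dist (of_real (1 + e / 2) * w) w < e"
            unfolding dist_norm using \<open>e > 0\<close> by linarith+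
          then show "\<exists>y\<in>{z. norm z > 1}. dist y w < e" by blast
        qed
        then show "insert w {z. norm z > 1} \<subseteq> closure {z. norm z > 1}"
          using closure_subset[of "{z. norm z > 1}"] by blast
      qed auto
      show ?thesis unfolding C_def using connected_Un[OF 1 2] by auto
    qed
    obtain w where "w \<in> circ" "w \<notin> K" using assms(2,3) by blast
    then have w: "norm w = 1" "w \<notin> K" by (auto simp: circ_def)
    have "- K = \<Union>(C ` (circ - K))"
    proof (intro equalityI subsetI)
      fix z assume "z \<in> - K"
      then show "z \<in> \<Union>(C ` (circ - K))"
        using w by (cases "norm z" "1::real" rule: linorder_cases) (auto simp: circ_def C_def)
    next
      fix z assume "z \<in> \<Union>(C ` (circ - K))"
      then show "z \<in> - K" using nK[of z] by (auto simp: C_def)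
    qed
    moreover have "connected (\<Union>(C ` (circ - K)))"
    proof (rule connected_Union)
      have "0 \<in> C x" for x by (simp add: C_def)
      then show "\<Inter>(C ` (circ - K)) \<noteq> {}" by blast
    qed (use C in \<open>auto simp: circ_def\<close>)
    ultimately show ?thesis by simp
  qed
  then have bors: "Borsukian K" using Borsukian_separation_compact[OF compK] by simp
  show ?thesis
    unfolding kronecker_set_def
  proof (intro conjI assms allI impI)
    fix u e assume u: "continuous_on K u \<and> u ` K \<subseteq> circ" and "(e::real) > 0"
    then obtain g where g: "continuous_on K (complex_of_real \<circ> g)" "\<And>z. z \<in> K \<Longrightarrow> u z = exp (\<i> * of_real (g z))"
    proof -
      have "u \<in> K \<rightarrow> sphere 0 1" using u by (auto simp: circ_def)
      then obtain g where "continuous_on K (complex_of_real \<circ> g) \<and> (\<forall>z\<in>K. u z = exp (\<i> * of_real (g z)))"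
        using bors[unfolded Borsukian_continuous_logarithm_circle_real, rule_format, of u] u by blast
      then show ?thesis using that[of g] by simp
    qed
    have cg: "continuous_on K g"
      using continuous_on_Re[OF g(1)] by simp
    have "approximable K u"
    proof (rule approximable_limit)
      fix d :: real assume "d > 0"
      obtain p where p: "trigpoly p" "\<And>z. z \<in> K \<Longrightarrow> \<bar>g z - p z\<bar> < d"
        using trigpoly_dense[OF compK cg \<open>d > 0\<close>] by blast
      have "approximable K (\<lambda>z. cis (1 * p z))" using Vtrig[OF p(1)] unfolding V_def by blast
      moreover have "norm (u z - cis (1 * p z)) \<le> d" if "z \<in> K" for z
        using norm_cis_diff_le[of "g z" "p z"] p(2)[OF that] g(2)[OF that] by (simp add: cis_conv_exp)
      ultimately show "\<exists>v. approximable K v \<and> (\<forall>z\<in>K. norm (u z - v z) \<le> d)" by blast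
    qed
    then show "\<exists>n::int. \<forall>z\<in>K. norm (u z - z powi n) < e"
      using \<open>e > 0\<close> unfolding approximable_def by blast
  qed
qed

section \<open>A schedule of phases and tolerances, and the support of the limit\<close>

theorem theorem4p1:
  assumes "multiplicity_set E"
  shows "\<exists>\<mu>. distribution \<mu> \<and> nonzero_distr \<mu> \<and>
           kronecker_set (distr_support \<mu>) \<and> distr_support \<mu> \<subseteq> E \<and>
           (fourier_coeff \<mu> \<longlongrightarrow> 0) at_bot"
proof -
  obtain S where S: "distribution S" "nonzero_distr S" "distr_support S \<subseteq> E"
    "(fourier_coeff S \<longlongrightarrow> 0) at_top" "(fourier_coeff S \<longlongrightarrow> 0) at_bot"
    using assms unfolding multiplicity_set_def by blast
  have expi_fc: "T (expi m) = fourier_coeff T (- m)" for T m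
    by (simp add: fourier_coeff_expi)
  have psS: "pseudofunction S"
    unfolding pseudofunction_def expi_fc
    using S tendsto_uminus_int by blast
  \<comment> \<open>The phases demanded by \<open>kronecker_setI\<close>, indexed by a countable
    type; the Boolean selects 1 or \<i>.\<close>
  define \<Phi> :: "(nat \<times> nat) \<times> (nat \<times> bool) \<Rightarrow> complex \<Rightarrow> real"
    where "\<Phi> = (\<lambda>((a, b), (q, s)) z. Re ((if s then 1 else \<i>) * z ^ a * cnj z ^ b) / real (Suc q))"
  \<comment> \<open>Every pair of a phase and a number r occurs, and r sets the tolerance 1 / (r +
    1); so each phase is met with arbitrarily small tolerance.\<close>
  define idx :: "nat \<Rightarrow> ((nat \<times> nat) \<times> (nat \<times> bool)) \<times> nat" where "idx = from_nat"
  have surj_idx: "\<exists>j. idx j = x" for x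
    unfolding idx_def using surj_from_nat by (metis surjD)
  define \<phi> where "\<phi> j t = \<Phi> (fst (idx j)) (cis t)" for j t
  define \<delta> where "\<delta> j = 1 / real (Suc (snd (idx j)))" for j
  have cont_\<Phi>: "continuous_on A (\<Phi> x)" for A x
    by (cases x) (auto simp: \<Phi>_def split: prod.splits intro!: continuous_intros)
  have smooth_\<Phi>: "smooth_fun (\<lambda>t. complex_of_real (\<Phi> x (cis t)))" for x
  proof -
    obtain a b q s where x: "x = ((a, b), (q, s))" by (metis surj_pair)
    define \<kappa> where "\<kappa> = (if s then 1 else \<i>)"
    have "\<kappa> * cis t ^ a * cnj (cis t) ^ b = \<kappa> * expi (int a - int b) t" for t
      by (simp add: expi_cis Complex.DeMoivre cis_cnj cis_mult left_diff_distrib mult.assoc)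
    then have "\<Phi> x (cis t) = Re (\<kappa> * expi (int a - int b) t) / real (Suc q)" for t
      by (simp only: x \<Phi>_def \<kappa>_def[symmetric] prod.case)
    moreover have "complex_of_real (Re X / real (Suc q)) = of_real (1 / (2 * real (Suc q))) * (X + cnj X)" for X
      by (simp add: complex_eq_iff field_simps)
    ultimately have "complex_of_real (\<Phi> x (cis t)) = of_real (1 / (2 * real (Suc q))) * (\<kappa> * expi (int a - int b) t + cnj \<kappa> * expi (int b - int a) t)" for t
      by (simp only: complex_cnj_mult cnj_expi minus_diff_eq)
    moreover have "smooth_fun (\<lambda>t. of_real (1 / (2 * real (Suc q))) * (\<kappa> * expi (int a - int b) t + cnj \<kappa> * expi (int b - int a) t))"
      by (intro smooth_fun_add smooth_fun_mult smooth_fun_const test_fun_smooth test_fun_expi)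
    ultimately show ?thesis by simp
  qed
  obtain \<mu> n f where \<mu>: "distribution \<mu>" "nonzero_distr \<mu>" "((\<lambda>m. \<mu> (expi m)) \<longlongrightarrow> 0) at_top"
    and n: "\<And>j. n j \<ge> (1::nat)"
    and f: "\<And>j t. f j t \<noteq> 0 \<Longrightarrow> norm (cis t ^ n j - cis (\<phi> j t)) \<le> \<delta> j" "\<And>j. test_fun (f j)"
    and lim: "\<And>\<psi>. test_fun \<psi> \<Longrightarrow> (\<lambda>J. S (\<lambda>t. (\<Prod>j<J. f j t) * \<psi> t)) \<longlonglongrightarrow> \<mu> \<psi>"
  proof (rule limit_distribution[OF psS S(2), of \<phi> \<delta>])
    show "\<phi> j (t + 2 * pi) = \<phi> j t" for j t
      using expi_periodic[of 1 t] by (simp add: \<phi>_def expi_cis)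
  qed (use smooth_\<Phi> in \<open>auto simp: \<phi>_def \<delta>_def\<close>)
  define K where "K = distr_support \<mu>"
  have K_circ: "K \<subseteq> circ" by (auto simp: K_def distr_support_def)
  have "K \<subseteq> E"
  proof
    fix z assume z: "z \<in> K"
    show "z \<in> E"
    proof (rule ccontr)
      assume "z \<notin> E"
      then have "z \<notin> distr_support S" using S(3) by blast
      then obtain U where U: "open U" "z \<in> U"
        "\<And>\<psi>. test_fun \<psi> \<Longrightarrow> cis ` closure {t. \<psi> t \<noteq> 0} \<subseteq> U \<Longrightarrow> S \<psi> = 0"
        using z K_circ unfolding distr_support_def by blast
      have "z \<notin> distr_support \<mu>"
      proof (rule notin_distr_supportI[OF U(1,2)])
        fix \<psi> assume \<psi>: "test_fun \<psi>" "cis ` closure {t. \<psi> t \<noteq> 0} \<subseteq> U"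
        have "S (\<lambda>t. (\<Prod>j<J. f j t) * \<psi> t) = 0" for J
        proof (rule U(3))
          have "test_fun (\<lambda>t. \<Prod>j<J. f j t)" by (induction J) (auto intro: f(2))
          then show "test_fun (\<lambda>t. (\<Prod>j<J. f j t) * \<psi> t)" using \<psi>(1) by auto
          have "closure {t. (\<Prod>j<J. f j t) * \<psi> t \<noteq> 0} \<subseteq> closure {t. \<psi> t \<noteq> 0}"
            by (intro closure_mono) auto
          then show "cis ` closure {t. (\<Prod>j<J. f j t) * \<psi> t \<noteq> 0} \<subseteq> U" using \<psi>(2) by blast
        qed
        then have "(\<lambda>J::nat. 0) \<longlonglongrightarrow> \<mu> \<psi>" using lim[OF \<psi>(1)] by simp
        then show "\<mu> \<psi> = 0" using LIMSEQ_unique tendsto_const by blast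
      qed
      then show False using z by (simp add: K_def)
    qed
  qed
  \<comment> \<open>The inequality is known only where \<open>f j\<close> is nonzero. Its failure
    defines an open set, and a test function supported there is annihilated by every product
    containing \<open>f j\<close>, hence by the limit.\<close>
  have K_close: "norm (z ^ n j - cis (\<Phi> (fst (idx j)) z)) \<le> \<delta> j" if z: "z \<in> K" for z j
  proof (rule ccontr)
    define U where "U = {z. \<delta> j < norm (z ^ n j - cis (\<Phi> (fst (idx j)) z))}"
    assume "\<not> norm (z ^ n j - cis (\<Phi> (fst (idx j)) z)) \<le> \<delta> j"
    then have "z \<in> U" by (simp add: U_def)
    moreover have "open U"
      unfolding U_def by (intro open_Collect_less continuous_intros cont_\<Phi> continuous_on_cis)
    ultimately have "z \<notin> distr_support \<mu>"
    proof (intro notin_distr_supportI)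
      fix \<psi> assume \<psi>: "test_fun \<psi>" "cis ` closure {t. \<psi> t \<noteq> 0} \<subseteq> U"
      have f\<psi>: "f j t * \<psi> t = 0" for t
      proof (cases "cis t \<in> U")
        case True
        then have "f j t = 0" using f(1)[of j t] by (force simp: U_def \<phi>_def)
        then show ?thesis by simp
      next
        case False
        then show ?thesis using cis_image_closure_notin[OF \<psi>(2)] by simp
      qed
      have "S (\<lambda>t. (\<Prod>i<J. f i t) * \<psi> t) = 0" if "J > j" for J
      proof -
        have "(\<lambda>t. (\<Prod>i<J. f i t) * \<psi> t) = (\<lambda>t. 0)"
          using f\<psi> that by (auto simp: fun_eq_iff)
        then show ?thesis using distribution_0[OF S(1)] by (simp only:)
      qed
      then have "\<forall>\<^sub>F J in sequentially. S (\<lambda>t. (\<Prod>i<J. f i t) * \<psi> t) = 0"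
        using eventually_gt_at_top[of j] by (rule eventually_mono[rotated])
      then have "(\<lambda>J. S (\<lambda>t. (\<Prod>i<J. f i t) * \<psi> t)) \<longlonglongrightarrow> 0" by (rule tendsto_eventually)
      then show "\<mu> \<psi> = 0" using LIMSEQ_unique lim[OF \<psi>(1)] by blast
    qed
    then show False using z by (simp add: K_def)
  qed
  have "K \<noteq> circ"
  proof
    assume K: "K = circ"
    \<comment> \<open>\<open>False\<close> selects \<i>, so this is the phase Re \<i> = 0 with
      tolerance 1: on \<open>K\<close> the power z^n stays within 1 of 1. Since n is at least 1, the
      circle has a point with z^n = -1.\<close>
    obtain j where j: "idx j = (((0, 0), (0, False)), 0)" using surj_idx by blast
    define z where "z = cis (pi / real (n j))"
    have "z ^ n j = -1" using n[of j] by (simp add: z_def Complex.DeMoivre)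
    moreover have "z \<in> K" by (simp add: K circ_def z_def)
    moreover have "\<Phi> (fst (idx j)) z = 0" "\<delta> j = 1" by (simp_all add: j \<Phi>_def \<delta>_def)
    ultimately show False using K_close[of z j] by simp
  qed
  have "kronecker_set K"
  proof (rule kronecker_setI)
    show "closed K" unfolding K_def by (rule closed_distr_support)
    fix \<kappa> :: complex and a b q assume \<kappa>: "\<kappa> \<in> {1, \<i>}"
    show "approximable K (\<lambda>z. cis (Re (\<kappa> * z ^ a * cnj z ^ b) / real (Suc q)))"
      unfolding approximable_def
    proof (intro allI impI)
      fix e :: real assume "e > 0"
      then obtain r where r: "1 / real (Suc r) < e" using nat_approx_posE by blast
      obtain j where j: "idx j = (((a, b), (q, \<kappa> = 1)), r)" using surj_idx by blast
      have "norm (cis (Re (\<kappa> * z ^ a * cnj z ^ b) / real (Suc q)) - z powi int (n j)) < e" if "z \<in> K" for z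
      proof -
        have "\<Phi> (fst (idx j)) z = Re (\<kappa> * z ^ a * cnj z ^ b) / real (Suc q)"
          using \<kappa> by (auto simp: j \<Phi>_def)
        then show ?thesis
          using K_close[OF that, of j] r by (simp add: j \<delta>_def norm_minus_commute)
      qed
      then show "\<exists>n::int. \<forall>z\<in>K. norm (cis (Re (\<kappa> * z ^ a * cnj z ^ b) / real (Suc q)) - z powi n) < e"
        by blast
    qed
  qed (use K_circ \<open>K \<noteq> circ\<close> in auto)
  moreover have "(fourier_coeff \<mu> \<longlongrightarrow> 0) at_bot"
  proof -
    have "((\<lambda>m. \<mu> (expi (- m))) \<longlongrightarrow> 0) at_bot"
      by (rule tendsto_uminus_int(2)[OF \<mu>(3)])
    then show ?thesis by (simp add: fourier_coeff_expi[abs_def])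
  qed
  ultimately show ?thesis using \<mu> \<open>K \<subseteq> E\<close> unfolding K_def by blast
qed

end
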